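(* There is an algorithm that, given an instance $(A,B,k)$ of Max-Duo PSM with $|A|=|B|=n$, computes in time $O(n^{5/2}k^6)$ an instance $(A',B',k)$ of Max-Duo PSM (so $A'$ and $B'$ are related strings), with $|A'|$ and $|B'|$ bounded by $O(k^6)$, such that there exists a mapping of $A$ into $B$ preserving at least $k$ duos if and only if there exists a mapping of $A'$ into $B'$ preserving at least $k$ duos.
   Context: For a string $S$, $S[i]$ denotes its $i$-th symbol. A duo of $S$ is an ordered pair of consecutive symbols $(S[i],S[i+1])$, $1\le i\le |S|-1$. Two strings $A$ and $B$ are related if $B$ is a permutation of $A$. A mapping of $A$ into $B$ is a bijection $m$ from the positions of $A$ to the positions of $B$ such that $m(i)=j$ implies $A[i]=B[j]$. A duo $(A[i],A[i+1])$ is preserved by $m$ if $m(i)=j$ and $m(i+1)=j+1$ for some $j$. The Maximum-Duo Preservation String Mapping problem (Max-Duo PSM): given related strings $A,B$ and an integer $k$, decide whether there is a mapping of $A$ into $B$ preserving at least $k$ duos. *)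

theory Defs
  imports Complex_Main "HOL-Library.Multiset"
begin

section \<open>Max-Duo Preservation String Mapping\<close>

text \<open>Positions are counted from 0, so the duo \<open>i\<close> of \<open>A\<close> is \<open>(A ! i, A ! Suc i)\<close>.
  Duos are identified with their starting positions: equal duos at different
  positions are counted separately.\<close>

definition related :: "'a list \<Rightarrow> 'a list \<Rightarrow> bool" where
  "related A B \<longleftrightarrow> mset A = mset B"

definition is_mapping :: "(nat \<Rightarrow> nat) \<Rightarrow> 'a list \<Rightarrow> 'a list \<Rightarrow> bool" where
  "is_mapping m A B \<longleftrightarrow>
     bij_betw m {..<length A} {..<length B} \<and> (\<forall>i<length A. A ! i = B ! m i)"

definition preserved_duos :: "(nat \<Rightarrow> nat) \<Rightarrow> 'a list \<Rightarrow> nat set" where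
  "preserved_duos m A = {i. Suc i < length A \<and> (\<exists>j. m i = j \<and> m (Suc i) = Suc j)}"

definition max_duo_psm :: "'a list \<Rightarrow> 'a list \<Rightarrow> nat \<Rightarrow> bool" where
  "max_duo_psm A B k \<longleftrightarrow> (\<exists>m. is_mapping m A B \<and> k \<le> card (preserved_duos m A))"


section \<open>Machine model\<close>

text \<open>A unit-cost random access machine with addition and truncated subtraction (no
  multiplication) and structured control flow. Its store consists of registers and of
  unbounded arrays of natural numbers. A program mentions only finitely many
  registers and arrays, so this is a single random access memory in which cell \<open>i\<close> of
  array \<open>a\<close> sits at an address of the form \<open>c * i + d\<close> with constants \<open>c\<close>, \<open>d\<close>.\<close>

record store =
  reg :: "nat \<Rightarrow> nat"
  arr :: "nat \<Rightarrow> nat \<Rightarrow> nat"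

datatype aexp =
    Const nat
  | Reg nat
  | Cell nat aexp
  | Plus aexp aexp
  | Minus aexp aexp

datatype bexp =
    Less aexp aexp
  | Equal aexp aexp
  | Neg bexp
  | Conj bexp bexp

datatype com =
    Skip
  | SetReg nat aexp
  | SetCell nat aexp aexp
  | Seq com com
  | Cond bexp com com
  | While bexp com

fun aval :: "aexp \<Rightarrow> store \<Rightarrow> nat" where
  "aval (Const n) s = n"
| "aval (Reg x) s = reg s x"
| "aval (Cell a e) s = arr s a (aval e s)"
| "aval (Plus e1 e2) s = aval e1 s + aval e2 s"
| "aval (Minus e1 e2) s = aval e1 s - aval e2 s"

fun bval :: "bexp \<Rightarrow> store \<Rightarrow> bool" where
  "bval (Less e1 e2) s \<longleftrightarrow> aval e1 s < aval e2 s"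
| "bval (Equal e1 e2) s \<longleftrightarrow> aval e1 s = aval e2 s"
| "bval (Neg b) s \<longleftrightarrow> \<not> bval b s"
| "bval (Conj b1 b2) s \<longleftrightarrow> bval b1 s \<and> bval b2 s"

text \<open>\<open>exec c s t s'\<close>: started in store \<open>s\<close>, the program \<open>c\<close> halts after \<open>t\<close> time units
  in store \<open>s'\<close>. Every assignment and every test costs one unit. The expressions
  occurring in a fixed program have bounded size, so counting each of their operators
  as well would change running times only by a constant factor.\<close>

inductive exec :: "com \<Rightarrow> store \<Rightarrow> nat \<Rightarrow> store \<Rightarrow> bool" where
  Skip: "exec Skip s 1 s"
| SetReg: "exec (SetReg x e) s 1 (s\<lparr>reg := (reg s)(x := aval e s)\<rparr>)"
| SetCell: "exec (SetCell a i e) s 1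
    (s\<lparr>arr := (arr s)(a := (arr s a)(aval i s := aval e s))\<rparr>)"
| Seq: "exec c1 s t1 s1 \<Longrightarrow> exec c2 s1 t2 s2 \<Longrightarrow> exec (Seq c1 c2) s (t1 + t2) s2"
| CondTrue: "bval b s \<Longrightarrow> exec c1 s t s1 \<Longrightarrow> exec (Cond b c1 c2) s (1 + t) s1"
| CondFalse: "\<not> bval b s \<Longrightarrow> exec c2 s t s1 \<Longrightarrow> exec (Cond b c1 c2) s (1 + t) s1"
| WhileFalse: "\<not> bval b s \<Longrightarrow> exec (While b c) s 1 s"
| WhileTrue: "bval b s \<Longrightarrow> exec c s t1 s1 \<Longrightarrow> exec (While b c) s1 t2 s2
    \<Longrightarrow> exec (While b c) s (1 + t1 + t2) s2"

lemma exec_deterministic: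
  "exec c s t s' \<Longrightarrow> exec c s u s'' \<Longrightarrow> u = t \<and> s'' = s'"
proof (induction arbitrary: u s'' rule: exec.induct)
  case (Skip s)
  then show ?case by cases auto
next
  case (SetReg x e s)
  then show ?case by cases auto
next
  case (SetCell a i e s)
  then show ?case by cases auto
next
  case (Seq c1 s t1 s1 c2 t2 s2)
  from Seq.prems show ?case by cases (use Seq.IH in metis)
next
  case (CondTrue b s c1 t s1 c2)
  from CondTrue.prems show ?case by cases (use CondTrue.IH CondTrue.hyps(1) in metis)+
next
  case (CondFalse b s c2 t s1 c1)
  from CondFalse.prems show ?case by cases (use CondFalse.IH CondFalse.hyps(1) in metis)+
next
  case (WhileFalse b s c)
  from WhileFalse.prems show ?case by cases (use WhileFalse.hyps(1) in auto)
next
  case (WhileTrue b s c t1 s1 t2 s2)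
  from WhileTrue.prems show ?case by cases (use WhileTrue.IH WhileTrue.hyps(1) in metis)+
qed


section \<open>Instances in the store\<close>

text \<open>Symbols are natural numbers, one per cell. Registers 0, 1, 2 contain the two lengths
  and the parameter; arrays 0 and 1 contain the two strings.\<close>

definition represents :: "store \<Rightarrow> nat list \<Rightarrow> nat list \<Rightarrow> nat \<Rightarrow> bool" where
  "represents s A B k \<longleftrightarrow>
     reg s 0 = length A \<and> reg s 1 = length B \<and> reg s 2 = k \<and>
     (\<forall>i<length A. arr s 0 i = A ! i) \<and> (\<forall>i<length B. arr s 1 i = B ! i)"

definition input_store :: "nat list \<Rightarrow> nat list \<Rightarrow> nat \<Rightarrow> store" where
  "input_store A B k =
     \<lparr>reg = (\<lambda>_. 0)(0 := length A, 1 := length B, 2 := k),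
      arr = (\<lambda>_ _. 0)(0 := (\<lambda>i. if i < length A then A ! i else 0),
                      1 := (\<lambda>i. if i < length B then B ! i else 0))\<rparr>"

lemma represents_input_store: "represents (input_store A B k) A B k"
  by (simp add: represents_def input_store_def)

end

theory Submission
  imports Defs "HOL-Combinatorics.List_Permutation"
begin

text \<open>A mapping preserving \<open>k\<close> duos amounts to pairwise disjoint blocks, that is, matching words
  of \<open>A\<close> and \<open>B\<close>, with \<open>k\<close> duos in total. Such blocks occupy at most \<open>2k\<close> positions, so each of
  them can be moved to one of the first \<open>5k\<^sup>2\<close> occurrences of its word without meeting another one.
  The kernel therefore keeps, in either string, only the duos covered by the first \<open>5k\<^sup>2\<close>
  occurrences of every word with at most \<open>k\<close> duos of the other string. If no mapping preserves \<open>k\<close>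
  duos, then a maximal family of disjoint common duos has fewer than \<open>k\<close> members and touches every
  common duo, which leaves only \<open>O(k\<^sup>5)\<close> kept duos; a larger kernel is replaced by a trivial
  yes-instance. Comparing all words naively takes time \<open>O(n\<^sup>2k\<^sup>2)\<close>.\<close>

section \<open>Blocks and mappings\<close>

text \<open>The constant \<open>5 * k * k\<close> comes from a count: the other blocks cover at most
  \<open>2 * k\<close> positions, each of which rules out at most \<open>k + 1\<close> starting
  points for the block to be moved, and \<open>2 * k * (k + 1)\<close> is below
  \<open>5 * k * k\<close> for positive \<open>k\<close>. Only one side moves at a time: while
  blocks move in \<open>A\<close>, their words are read in \<open>B\<close>, and vice versa. The
  marked parts cannot simply be cut out: the result must again be a pair of related strings,
  although the marked parts of \<open>A\<close> and of \<open>B\<close> may consist of different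
  symbols, and neither cutting nor repairing may create a common duo. Hence each kernel string
  receives the symbols of the other one in isolated form, and the two separators play opposite roles
  on the two sides, so that no artificial duo of one side occurs on the other. The kernelization
  never searches for a mapping: the size test alone certifies the yes-instances that it answers
  directly.\<close>

definition matches :: "'a list \<Rightarrow> 'a list \<Rightarrow> nat \<Rightarrow> nat \<Rightarrow> nat \<Rightarrow> bool" where
  "matches A B i j l \<longleftrightarrow>
     i + l < length A \<and> j + l < length B \<and> (\<forall>x\<le>l. A ! (i + x) = B ! (j + x))"

definition disjoint_segs :: "nat \<Rightarrow> (nat \<Rightarrow> nat) \<Rightarrow> (nat \<Rightarrow> nat) \<Rightarrow> bool" where
  "disjoint_segs m I l \<longleftrightarrow>
     (\<forall>r<m. \<forall>s<m. r \<noteq> s \<longrightarrow> {I r..I r + l r} \<inter> {I s..I s + l s} = {})"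

text \<open>\<open>l r\<close> counts duos, so a block has \<open>l r + 1\<close> symbols. The
  condition \<open>0 < l r\<close> gives \<open>l r + 1 \<le> 2 * l r\<close>; this is why blocks
  with \<open>k\<close> duos in total occupy at most \<open>2 * k\<close> positions.\<close>

definition blocks ::
  "'a list \<Rightarrow> 'a list \<Rightarrow> nat \<Rightarrow> (nat \<Rightarrow> nat) \<Rightarrow> (nat \<Rightarrow> nat) \<Rightarrow> (nat \<Rightarrow> nat) \<Rightarrow> bool" where
  "blocks A B m I J l \<longleftrightarrow>
     (\<forall>r<m. 0 < l r \<and> matches A B (I r) (J r) (l r)) \<and> disjoint_segs m I l \<and> disjoint_segs m J l"

lemma matches_sym: "matches A B i j l \<longleftrightarrow> matches B A j i l"
  by (auto simp: matches_def)

lemma matches_mono: "matches A B i j l \<Longrightarrow> x + l' \<le> l \<Longrightarrow> matches A B (i + x) (j + x) l'"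
  by (auto simp: matches_def add.assoc)

lemma blocks_sym: "blocks A B m I J l \<longleftrightarrow> blocks B A m J I l"
  by (auto simp: blocks_def matches_sym)

lemma disjoint_segs_Suc:
  "disjoint_segs (Suc m) I l \<longleftrightarrow>
     disjoint_segs m I l \<and> (\<forall>r<m. {I r..I r + l r} \<inter> {I m..I m + l m} = {})"
proof
  assume "disjoint_segs m I l \<and> (\<forall>r<m. {I r..I r + l r} \<inter> {I m..I m + l m} = {})"
  then show "disjoint_segs (Suc m) I l"
    unfolding disjoint_segs_def less_Suc_eq using Int_commute by (smt (verit) less_irrefl)
qed (auto simp: disjoint_segs_def)

lemma disjoint_segs_cong:
  "(\<And>r. r < m \<Longrightarrow> I r = I' r) \<Longrightarrow> (\<And>r. r < m \<Longrightarrow> l r = l' r) \<Longrightarrow>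
     disjoint_segs m I l = disjoint_segs m I' l'"
  by (simp add: disjoint_segs_def)

lemma segs_inter_empty_iff:
  fixes a b :: nat
  shows "{a..a + l} \<inter> {b..b + l'} = {} \<longleftrightarrow> a + l < b \<or> b + l' < a"
proof -
  \<comment> \<open>Two segments that meet have the larger of their starting points in
    common.\<close>
  have "a + l < b \<or> b + l' < a" if "max a b \<notin> {a..a + l} \<inter> {b..b + l'}"
    using that by auto
  then show ?thesis by auto
qed

section \<open>Mappings preserving duos correspond to families of disjoint blocks\<close>

lemma is_mapping_exists:
  assumes "related A B" shows "\<exists>m. is_mapping m A B"
  using permutation_Ex_bij[of A B] assms unfolding related_def is_mapping_def by auto

text \<open>An exchange argument: start from any mapping and force one prescribed value at a time.
  If \<open>m\<close> sends \<open>p'\<close> to \<open>\<phi> p\<close>, the images of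
  \<open>p\<close> and \<open>p'\<close> are swapped; both positions carry the same symbol, and
  \<open>p'\<close> lies outside \<open>D\<close> by injectivity of \<open>\<phi>\<close>, so the
  values forced earlier survive.\<close>

lemma extend_to_mapping:
  assumes "related A B" "finite D" "D \<subseteq> {..<length A}" "\<phi> ` D \<subseteq> {..<length B}" "inj_on \<phi> D"
    "\<And>p. p \<in> D \<Longrightarrow> A ! p = B ! \<phi> p"
  shows "\<exists>m. is_mapping m A B \<and> (\<forall>p\<in>D. m p = \<phi> p)"
  using assms(2-)
proof (induction D rule: finite_induct)
  case empty
  then show ?case using is_mapping_exists[OF assms(1)] by simp
next
  case (insert p D)
  then obtain m where m: "is_mapping m A B" "\<forall>p\<in>D. m p = \<phi> p" by auto
  then have bij: "bij_betw m {..<length A} {..<length B}" by (simp add: is_mapping_def)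
  have "\<phi> p \<in> {..<length B}" using insert.prems by auto
  then obtain p' where p': "p' < length A" "m p' = \<phi> p"
    using bij by (metis bij_betw_iff_bijections lessThan_iff)
  have p: "p < length A" using insert.prems by auto
  have notin: "p' \<notin> D"
    using m(2) p' insert.prems(3) insert.hyps(2) by (auto simp: inj_on_def)
  \<comment> \<open>If \<open>p = p'\<close>, the second update wins, and then \<open>m p\<close> is
    already \<open>\<phi> p\<close>.\<close>
  define m' where "m' = m(p := \<phi> p, p' := m p)"
  have "bij_betw m' {..<length A} {..<length B}"
  proof -
    have "m' = m \<circ> Transposition.transpose p p'"
      using p' by (auto simp: m'_def fun_eq_iff Transposition.transpose_def)
    moreover have "bij_betw (Transposition.transpose p p') {..<length A} {..<length A}"
      using p p' by (auto simp: bij_betw_def)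
    ultimately show ?thesis using bij bij_betw_trans by metis
  qed
  moreover have "A ! i = B ! m' i" if "i < length A" for i
    using m(1) that p p' insert.prems(4)[of p] by (auto simp: m'_def is_mapping_def)
  moreover have "m' q = \<phi> q" if "q \<in> insert p D" for q
    using that m(2) notin p' insert.hyps(2) by (auto simp: m'_def)
  ultimately show ?case by (auto simp: is_mapping_def)
qed

text \<open>Shifting every block of \<open>A\<close> onto its partner in \<open>B\<close> is a
  symbol-preserving partial map, well defined and injective because both families are disjoint. Any
  mapping that extends it preserves all duos inside the blocks.\<close>

lemma max_duo_psm_blocks_intro:
  assumes rel: "related A B" and bl: "blocks A B m I J l" and k: "k \<le> (\<Sum>r<m. l r)"
  shows "max_duo_psm A B k"
proof -
  define S where "S r = {I r..I r + l r}" for r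
  define D where "D = (\<Union>r<m. S r)"
  have disjI: "S r \<inter> S s = {}" if "r < m" "s < m" "r \<noteq> s" for r s
    using bl that by (auto simp: blocks_def disjoint_segs_def S_def)
  have disjJ: "{J r..J r + l r} \<inter> {J s..J s + l s} = {}" if "r < m" "s < m" "r \<noteq> s" for r s
    using bl that by (auto simp: blocks_def disjoint_segs_def)
  have mt: "matches A B (I r) (J r) (l r)" if "r < m" for r
    using bl that by (auto simp: blocks_def)
  define \<rho> where "\<rho> p = (THE r. r < m \<and> p \<in> S r)" for p
  have \<rho>: "\<rho> p = r" if "r < m" "p \<in> S r" for p r
    unfolding \<rho>_def using that disjI by blast
  define \<phi> where "\<phi> p = J (\<rho> p) + (p - I (\<rho> p))" for p
  have \<phi>: "\<phi> (I r + x) = J r + x" if "r < m" "x \<le> l r" for r x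
    using \<rho>[of r "I r + x"] that by (simp add: \<phi>_def S_def)
  have D: "\<exists>r x. r < m \<and> x \<le> l r \<and> p = I r + x" if "p \<in> D" for p
  proof -
    from that obtain r where "r < m" "I r \<le> p" "p \<le> I r + l r" by (auto simp: D_def S_def)
    then show ?thesis by (intro exI[of _ r] exI[of _ "p - I r"]) auto
  qed
  have fin: "finite D" by (simp add: D_def S_def)
  have sub: "D \<subseteq> {..<length A}"
    using D mt by (fastforce simp: matches_def)
  have im: "\<phi> ` D \<subseteq> {..<length B}"
  proof
    fix q assume "q \<in> \<phi> ` D"
    then obtain r x where "r < m" "x \<le> l r" "q = J r + x" using D \<phi> by blast
    then show "q \<in> {..<length B}" using mt[of r] by (auto simp: matches_def)
  qed
  have inj: "inj_on \<phi> D"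
  proof (rule inj_onI)
    fix p q assume pq: "p \<in> D" "q \<in> D" "\<phi> p = \<phi> q"
    obtain r x where r: "r < m" "x \<le> l r" "p = I r + x" using D[OF pq(1)] by blast
    obtain s y where s: "s < m" "y \<le> l s" "q = I s + y" using D[OF pq(2)] by blast
    have eq: "J r + x = J s + y" using pq(3) r s \<phi> by simp
    have "r = s"
    proof (rule ccontr)
      assume "r \<noteq> s"
      moreover have "J r + x \<in> {J r..J r + l r} \<inter> {J s..J s + l s}"
        using r s eq by auto
      ultimately show False using disjJ r s by blast
    qed
    then show "p = q" using eq r s by simp
  qed
  have sym: "A ! p = B ! \<phi> p" if "p \<in> D" for p
  proof -
    obtain r x where "r < m" "x \<le> l r" "p = I r + x" using D[OF \<open>p \<in> D\<close>] by blast
    then show ?thesis using mt[of r] \<phi> by (auto simp: matches_def)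
  qed
  obtain f where f: "is_mapping f A B" "\<forall>p\<in>D. f p = \<phi> p"
    using extend_to_mapping[OF rel fin sub im inj sym] by blast
  \<comment> \<open>The starting positions of the duos of a block are all its positions except the
    last one, which makes \<open>l r\<close> of them.\<close>
  define Q where "Q = (\<Union>r<m. {I r..<I r + l r})"
  have "Q \<subseteq> preserved_duos f A"
  proof
    fix p assume "p \<in> Q"
    then obtain r where r: "r < m" "I r \<le> p" "p < I r + l r" by (auto simp: Q_def)
    define x where "x = p - I r"
    have x: "p = I r + x" "Suc p = I r + Suc x" "x < l r" using r by (auto simp: x_def)
    have "p \<in> S r" "Suc p \<in> S r" using r by (auto simp: S_def)
    then have "p \<in> D" "Suc p \<in> D" using r(1) by (auto simp: D_def)
    then have "f p = J r + x" "f (Suc p) = J r + Suc x"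
      using f(2) \<phi>[of r x] \<phi>[of r "Suc x"] r(1) x by auto
    moreover have "Suc p < length A" using \<open>Suc p \<in> D\<close> sub by auto
    ultimately show "p \<in> preserved_duos f A" by (simp add: preserved_duos_def)
  qed
  moreover have "finite (preserved_duos f A)"
    by (rule finite_subset[of _ "{..<length A}"]) (auto simp: preserved_duos_def)
  moreover have "card Q = (\<Sum>r<m. card {I r..<I r + l r})"
    unfolding Q_def
  proof (rule card_UN_disjoint)
    show "\<forall>r\<in>{..<m}. \<forall>s\<in>{..<m}. r \<noteq> s \<longrightarrow> {I r..<I r + l r} \<inter> {I s..<I s + l s} = {}"
      using disjI by (fastforce simp: S_def)
  qed auto
  ultimately have "k \<le> card (preserved_duos f A)"
    using k card_mono[of "preserved_duos f A" Q] by simp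
  then show ?thesis using f(1) by (auto simp: max_duo_psm_def)
qed

text \<open>\<open>P\<close> stands for a set of duos, and a run of \<open>l r\<close> consecutive
  duos covers \<open>l r + 1\<close> positions. The runs therefore have to be maximal: two runs that
  touch would share a position. The induction splits off the last maximal run.\<close>

lemma finite_nat_set_runs:
  assumes "finite (P :: nat set)"
  shows "\<exists>m I l. (\<forall>r<m. 0 < l r \<and> {I r..<I r + l r} \<subseteq> P) \<and> disjoint_segs m I l \<and>
    (\<Sum>r<m. l r) = card P"
  using assms
proof (induction "card P" arbitrary: P rule: less_induct)
  case less
  show ?case
  proof (cases "P = {}")
    case True
    then show ?thesis by (intro exI[of _ 0]) (auto simp: disjoint_segs_def)
  next
    case False
    define e where "e = Max P"
    define a where "a = (LEAST a. {a..e} \<subseteq> P)"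
    have e: "e \<in> P" "\<And>x. x \<in> P \<Longrightarrow> x \<le> e" using False less.prems by (auto simp: e_def)
    have "{e..e} \<subseteq> P" using e by auto
    then have a: "{a..e} \<subseteq> P" "a \<le> e"
      unfolding a_def by (rule LeastI, rule Least_le)
    have before: "x \<notin> P" if "Suc x = a" for x
    proof
      assume "x \<in> P"
      moreover have "{x..e} = insert x {a..e}" using that a(2) by auto
      ultimately have "a \<le> x" using a unfolding a_def by (intro Least_le) auto
      then show False using that by simp
    qed
    define P' where "P' = P - {a..e}"
    have cardP: "card P = card P' + (Suc e - a)"
      using card_Diff_subset[OF _ a(1)] card_mono[OF less.prems a(1)] by (simp add: P'_def)
    have "card P' < card P" using cardP a(2) by simp
    moreover have "finite P'" using less.prems by (simp add: P'_def)
    ultimately obtain m I l where IH: "\<forall>r<m. 0 < l r \<and> {I r..<I r + l r} \<subseteq> P'"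
      "disjoint_segs m I l" "(\<Sum>r<m. l r) = card P'"
      using less.hyps by blast
    \<comment> \<open>The last duo of an earlier run lies below \<open>a\<close> and is not
      \<open>a - 1\<close>, which is outside \<open>P\<close>. Hence even the additional end
      position of its segment stays below \<open>a\<close>.\<close>
    have gap: "I r + l r < a" if "r < m" for r
    proof -
      have "0 < l r" "{I r..<I r + l r} \<subseteq> P'" using IH(1) that by auto
      then have "I r + l r - 1 \<in> P'" by auto
      then have "I r + l r - 1 < a" using e by (fastforce simp: P'_def)
      moreover have "Suc (I r + l r - 1) \<noteq> a"
        using before \<open>I r + l r - 1 \<in> P'\<close> by (auto simp: P'_def)
      ultimately show ?thesis using \<open>0 < l r\<close> by linarith
    qed
    define I' l' where "I' = I(m := a)" and "l' = l(m := Suc e - a)"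
    have "disjoint_segs m I' l'"
      using IH(2) disjoint_segs_cong[of m I I' l l'] by (simp add: I'_def l'_def)
    then have "disjoint_segs (Suc m) I' l'"
      using gap unfolding disjoint_segs_Suc segs_inter_empty_iff by (auto simp: I'_def l'_def)
    moreover have "{a..<a + (Suc e - a)} \<subseteq> P" using a by auto
    then have "\<forall>r<Suc m. 0 < l' r \<and> {I' r..<I' r + l' r} \<subseteq> P"
      using IH(1) a(2) by (auto simp: I'_def l'_def less_Suc_eq P'_def)
    moreover have "(\<Sum>r<Suc m. l' r) = card P"
      using IH(3) cardP by (simp add: l'_def)
    ultimately show ?thesis by blast
  qed
qed

text \<open>On a run of consecutive preserved duos the mapping is a shift, so it carries the run
  onto a matching segment of \<open>B\<close>.\<close>

lemma max_duo_psm_blocks_elim: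
  assumes "max_duo_psm A B k"
  obtains m I J l where "blocks A B m I J l" "(\<Sum>r<m. l r) = k"
proof -
  obtain f where f: "is_mapping f A B" "k \<le> card (preserved_duos f A)"
    using assms by (auto simp: max_duo_psm_def)
  \<comment> \<open>Exactly \<open>k\<close> duos are retained, so that no block has more than
    \<open>k\<close> duos, the length up to which \<open>marks\<close> considers words.\<close>
  obtain P where P: "P \<subseteq> preserved_duos f A" "card P = k" "finite P"
    using f(2) by (rule obtain_subset_with_card_n)
  obtain m I l where runs: "\<forall>r<m. 0 < l r \<and> {I r..<I r + l r} \<subseteq> P"
    "disjoint_segs m I l" "(\<Sum>r<m. l r) = k"
    using finite_nat_set_runs[OF P(3)] P(2) by blast
  have pres: "Suc p < length A" "f (Suc p) = Suc (f p)" if "p \<in> P" for p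
    using P(1) that by (auto simp: preserved_duos_def)
  have shift: "f (I r + x) = f (I r) + x" if "r < m" "x \<le> l r" for r x
    using that(2)
  proof (induction x)
    case (Suc x)
    then have "I r + x \<in> P" using runs(1) that(1) by force
    then show ?case using Suc pres(2) by simp
  qed simp
  have len: "I r + x < length A" if "r < m" "x \<le> l r" for r x
  proof -
    have "I r + (l r - 1) \<in> P" using runs(1) that(1) by force
    then show ?thesis using pres(1)[of "I r + (l r - 1)"] that by simp
  qed
  have flen: "f p < length B" "A ! p = B ! f p" if "p < length A" for p
    using f(1) that by (auto simp: is_mapping_def bij_betw_def)
  have finj: "p = q" if "p < length A" "q < length A" "f p = f q" for p q
    using f(1) that by (auto simp: is_mapping_def bij_betw_def inj_on_def)
  define J where "J r = f (I r)" for r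
  have "matches A B (I r) (J r) (l r)" if "r < m" for r
    using len[OF that] flen shift[OF that] unfolding matches_def J_def by (metis order_refl)
  moreover have "disjoint_segs m J l"
    unfolding disjoint_segs_def
  proof (intro allI impI equals0I)
    fix r s q assume rs: "r < m" "s < m" "r \<noteq> s"
      and q: "q \<in> {J r..J r + l r} \<inter> {J s..J s + l s}"
    define x y where "x = q - J r" and "y = q - J s"
    have xy: "x \<le> l r" "y \<le> l s" "q = J r + x" "q = J s + y" using q by (auto simp: x_def y_def)
    have "f (I r + x) = f (I s + y)"
      using xy shift[OF rs(1) xy(1)] shift[OF rs(2) xy(2)] by (simp add: J_def)
    then have "I r + x = I s + y"
      by (rule finj[OF len[OF rs(1) xy(1)] len[OF rs(2) xy(2)]])
    then have "I r + x \<in> {I r..I r + l r} \<inter> {I s..I s + l s}" using xy by auto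
    then show False using runs(2) rs unfolding disjoint_segs_def by blast
  qed
  ultimately have "blocks A B m I J l" using runs by (auto simp: blocks_def)
  then show ?thesis using runs(3) that by blast
qed

section \<open>Marked gaps\<close>

text \<open>A word of \<open>B\<close> is named by its starting point \<open>j\<close> and its
  number of duos \<open>l\<close>. Counting the earlier occurrences makes the selection depend on
  the word alone and lets one pass with a counter compute it.\<close>

definition selected :: "nat \<Rightarrow> 'a list \<Rightarrow> 'a list \<Rightarrow> nat \<Rightarrow> nat \<Rightarrow> nat \<Rightarrow> bool" where
  "selected L A B i j l \<longleftrightarrow>
     matches A B i j l \<and> card {i'. i' < i \<and> matches A B i' j l} < L"

text \<open>The duo of positions \<open>p - 1\<close> and \<open>p\<close> is represented by \<open>p\<close>, so that position \<open>p\<close> lies in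
  a marked duo iff \<open>p\<close> or \<open>Suc p\<close> is marked.\<close>

definition marks :: "nat \<Rightarrow> nat \<Rightarrow> 'a list \<Rightarrow> 'a list \<Rightarrow> nat set" where
  "marks L k A B = {p. \<exists>i j l. 0 < l \<and> l \<le> k \<and> selected L A B i j l \<and> i < p \<and> p \<le> i + l}"

text \<open>An occurrence that is not selected has at least \<open>L\<close> selected ones before
  it. Each position of \<open>X\<close> lies in at most \<open>l + 1\<close> of their segments, so
  one of these segments avoids \<open>X\<close>.\<close>

lemma selected_avoiding:
  assumes "matches A B i j l" "finite X" "card X * (l + 1) < L"
  shows "\<exists>i'. selected L A B i' j l \<and> (i' = i \<or> {i'..i' + l} \<inter> X = {})"
proof (cases "selected L A B i j l")
  case False
  define R where "R i \<longleftrightarrow> matches A B i j l \<and> L \<le> card {i'. i' < i \<and> matches A B i' j l}" for i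
  \<comment> \<open>The first occurrence with at least \<open>L\<close> predecessors: by minimality,
    all occurrences before it are selected.\<close>
  define i0 where "i0 = (LEAST i. R i)"
  have "R i" using False assms(1) by (auto simp: R_def selected_def)
  then have R0: "R i0" unfolding i0_def by (rule LeastI)
  have least: "\<not> R i'" if "i' < i0" for i' using that unfolding i0_def by (rule not_less_Least)
  define T where "T = {i'. i' < i0 \<and> matches A B i' j l}"
  have sel: "selected L A B i' j l" if "i' \<in> T" for i'
    using least that by (fastforce simp: T_def R_def selected_def)
  \<comment> \<open>\<open>{x - l..x}\<close> contains every starting point of a segment of
    \<open>l + 1\<close> positions through \<open>x\<close>.\<close>
  define Y where "Y = (\<Union>x\<in>X. {x - l..x})"
  have "card Y \<le> (\<Sum>x\<in>X. card {x - l..x})"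
    unfolding Y_def using assms(2) by (rule card_UN_le)
  also have "\<dots> \<le> (\<Sum>x\<in>X. l + 1)" by (rule sum_mono) auto
  also have "\<dots> < card T" using assms(3) R0 by (simp add: R_def T_def)
  finally have "card Y < card T" .
  moreover have "finite Y" using assms(2) by (simp add: Y_def)
  ultimately obtain i' where i': "i' \<in> T" "i' \<notin> Y"
    using card_mono[of Y T] by fastforce
  then have "{i'..i' + l} \<inter> X = {}" by (fastforce simp: Y_def)
  then show ?thesis using sel i' by blast
qed (use assms in blast)

text \<open>The blocks move one after the other, while their starting points in \<open>B\<close>,
  and thereby their words, stay fixed. The obstacle in each move is the union of all other blocks,
  whether moved already or not, so the family remains disjoint throughout.\<close>

lemma relocate_blocks:
  assumes bl: "blocks A B m I J l" and sum: "(\<Sum>r<m. l r) \<le> k" and L: "2 * k * (k + 1) < L"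
  shows "\<exists>I'. blocks A B m I' J l \<and> (\<forall>r<m. selected L A B (I' r) (J r) (l r))"
proof -
  have "\<exists>I'. blocks A B m I' J l \<and> (\<forall>r<t. selected L A B (I' r) (J r) (l r))" if "t \<le> m" for t
    using that
  proof (induction t)
    case 0
    then show ?case using bl by auto
  next
    case (Suc t)
    then obtain I' where I': "blocks A B m I' J l" "\<forall>r<t. selected L A B (I' r) (J r) (l r)"
      by auto
    have t: "t < m" using Suc.prems by simp
    define X where "X = (\<Union>r\<in>{..<m} - {t}. {I' r..I' r + l r})"
    have pos: "0 < l r" if "r < m" for r using I'(1) that by (auto simp: blocks_def)
    have "card X \<le> (\<Sum>r\<in>{..<m} - {t}. card {I' r..I' r + l r})"
      unfolding X_def by (rule card_UN_le) simp
    also have "\<dots> \<le> (\<Sum>r<m. card {I' r..I' r + l r})"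
      by (rule sum_mono2) auto
    also have "\<dots> \<le> (\<Sum>r<m. 2 * l r)"
      by (rule sum_mono) (use pos in fastforce)
    also have "\<dots> \<le> 2 * k" using sum by (simp flip: sum_distrib_left)
    finally have "card X \<le> 2 * k" .
    moreover have "l t \<le> k"
      using sum t member_le_sum[of t "{..<m}" l] by simp
    ultimately have "card X * (l t + 1) \<le> 2 * k * (k + 1)" by (intro mult_mono) auto
    then have "card X * (l t + 1) < L" using L by simp
    moreover have "finite X" by (simp add: X_def)
    moreover have "matches A B (I' t) (J t) (l t)" using I'(1) t by (auto simp: blocks_def)
    ultimately obtain i where i: "selected L A B i (J t) (l t)"
      "i = I' t \<or> {i..i + l t} \<inter> X = {}"
      using selected_avoiding by blast
    define I'' where "I'' = I'(t := i)"
    have "blocks A B m I'' J l"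
    proof (cases "i = I' t")
      case True
      then show ?thesis using I'(1) by (simp add: I''_def)
    next
      case False
      then have dj: "{i..i + l t} \<inter> {I' r..I' r + l r} = {}" if "r < m" "r \<noteq> t" for r
        using i(2) that unfolding X_def by blast
      have "disjoint_segs m I' l" using I'(1) by (simp add: blocks_def)
      then have "disjoint_segs m I'' l"
        unfolding disjoint_segs_def I''_def segs_inter_empty_iff
        using dj[unfolded segs_inter_empty_iff] by (auto simp: disj_commute)
      then show ?thesis
        using I'(1) i(1) by (auto simp: blocks_def I''_def selected_def)
    qed
    moreover have "\<forall>r<Suc t. selected L A B (I'' r) (J r) (l r)"
      using I'(2) i(1) by (simp add: I''_def less_Suc_eq)
    ultimately show ?case by blast
  qed
  then show ?thesis by blast
qed

lemma selected_in_marks: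
  "selected L A B i j l \<Longrightarrow> 0 < l \<Longrightarrow> l \<le> k \<Longrightarrow> {i<..i + l} \<subseteq> marks L k A B"
  unfolding marks_def by (intro subsetI CollectI exI[of _ i] exI[of _ j] exI[of _ l]) auto

lemma marks_bounds: "p \<in> marks L k A B \<Longrightarrow> 0 < p \<and> p < length A"
  by (auto simp: marks_def selected_def matches_def)

text \<open>The second relocation, in \<open>B\<close>, reads the words at the new starting points
  \<open>I'\<close>. It leaves \<open>I'\<close> unchanged, and \<open>marks\<close> asks only for
  some word of the other string, so what was marked in \<open>A\<close> remains so.\<close>

lemma blocks_in_marks:
  assumes "blocks A B m I J l" "(\<Sum>r<m. l r) = k" "2 * k * (k + 1) < L"
  shows "\<exists>I' J'. blocks A B m I' J' l \<and>
    (\<forall>r<m. {I' r<..I' r + l r} \<subseteq> marks L k A B \<and> {J' r<..J' r + l r} \<subseteq> marks L k B A)"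
proof -
  obtain I' where I': "blocks A B m I' J l" "\<forall>r<m. selected L A B (I' r) (J r) (l r)"
    using relocate_blocks[OF assms(1) _ assms(3)] assms(2) by auto
  obtain J' where J': "blocks B A m J' I' l" "\<forall>r<m. selected L B A (J' r) (I' r) (l r)"
    using relocate_blocks[OF I'(1)[unfolded blocks_sym[of A]] _ assms(3)] assms(2) by auto
  have "0 < l r \<and> l r \<le> k" if "r < m" for r
    using that assms(1,2) member_le_sum[of r "{..<m}" l] by (auto simp: blocks_def)
  then show ?thesis using I' J' blocks_sym selected_in_marks by metis
qed

section \<open>The number of marks\<close>

lemma card_selected_le: "card {i. selected L A B i j l} \<le> L"
proof -
  define T where "T = {i. selected L A B i j l}"
  have fin: "finite T"
    by (rule finite_subset[of _ "{..<length A}"]) (auto simp: T_def selected_def matches_def)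
  show ?thesis
  proof (cases "T = {}")
    case False
    \<comment> \<open>The last selected occurrence has fewer than \<open>L\<close> predecessors,
      among them all other selected ones.\<close>
    define i where "i = Max T"
    have i: "i \<in> T" "\<And>x. x \<in> T \<Longrightarrow> x \<le> i" using fin False by (auto simp: i_def)
    have "T - {i} \<subseteq> {i'. i' < i \<and> matches A B i' j l}"
      using i by (force simp: T_def selected_def)
    then have "card (T - {i}) \<le> card {i'. i' < i \<and> matches A B i' j l}"
      by (rule card_mono[rotated]) simp
    also have "\<dots> < L" using i(1) by (simp add: T_def selected_def)
    finally show ?thesis using i(1) fin by (simp add: T_def)
  qed (simp add: T_def)
qed

lemma card_UN_le_mult:
  assumes "finite S" "card S \<le> a" "\<And>x. x \<in> S \<Longrightarrow> card (F x) \<le> b"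
  shows "card (\<Union>x\<in>S. F x) \<le> a * b"
proof -
  have "card (\<Union>x\<in>S. F x) \<le> (\<Sum>x\<in>S. card (F x))" using assms(1) by (rule card_UN_le)
  also have "\<dots> \<le> card S * b" using sum_bounded_above[of S "\<lambda>x. card (F x)" b] assms(3) by simp
  also have "\<dots> \<le> a * b" using assms(2) by simp
  finally show ?thesis .
qed

text \<open>A maximal family of pairwise disjoint common duos touches every common duo, in \<open>A\<close> or in
  \<open>B\<close>. A selected occurrence that is untouched in \<open>A\<close> matches a word of \<open>B\<close> whose starting point
  is one of \<open>O(k)\<close> many.\<close>

lemma card_marks_le:
  assumes no: "\<And>m I J l. blocks A B m I J l \<Longrightarrow> (\<Sum>r<m. l r) < k"
  shows "card (marks L k A B) \<le> 2 * k * (2 * k + 1) + 2 * k * 2 * (k * (L * k))"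
proof -
  define S where "S = {m. \<exists>I J. blocks A B m I J (\<lambda>_. 1)}"
  \<comment> \<open>\<open>m\<close> disjoint common duos are \<open>m\<close> blocks of one duo
    each, hence \<open>m\<close> duos in total.\<close>
  have "S \<subseteq> {..<k}"
  proof
    fix m assume "m \<in> S"
    then obtain I J where "blocks A B m I J (\<lambda>_. 1)" by (auto simp: S_def)
    from no[OF this] show "m \<in> {..<k}" by simp
  qed
  then have finS: "finite S" using finite_subset by blast
  have "0 \<in> S" by (auto simp: S_def blocks_def disjoint_segs_def)
  define m where "m = Max S"
  have "m \<in> S" using finS \<open>0 \<in> S\<close> Max_in unfolding m_def by blast
  then obtain I J where IJ: "blocks A B m I J (\<lambda>_. 1)" by (auto simp: S_def)
  have mk: "m \<le> k" using \<open>m \<in> S\<close> \<open>S \<subseteq> {..<k}\<close> by auto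
  have "Suc m \<notin> S" using Max_ge[OF finS, of "Suc m"] by (auto simp: m_def)
  define MA MB where "MA = (\<Union>r<m. {I r..I r + 1})" and "MB = (\<Union>r<m. {J r..J r + 1})"
  have fin: "finite MA" "finite MB" unfolding MA_def MB_def by blast+
  have "card MA \<le> m * 2" "card MB \<le> m * 2"
    using card_UN_le_mult[of "{..<m}" m "\<lambda>r. {I r..I r + 1}" 2]
      card_UN_le_mult[of "{..<m}" m "\<lambda>r. {J r..J r + 1}" 2] by (simp_all add: MA_def MB_def)
  then have cards: "card MA \<le> 2 * k" "card MB \<le> 2 * k" using mk by linarith+
  have touch: "{i..i + 1} \<inter> MA \<noteq> {} \<or> {j..j + 1} \<inter> MB \<noteq> {}" if "matches A B i j 1" for i j
  proof (rule ccontr)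
    assume "\<not> ?thesis"
    then have new: "\<forall>r<m. {I r..I r + 1} \<inter> {i..i + 1} = {}" "\<forall>r<m. {J r..J r + 1} \<inter> {j..j + 1} = {}"
      unfolding MA_def MB_def by blast+
    define I' J' where "I' = I(m := i)" and "J' = J(m := j)"
    have "disjoint_segs m I' (\<lambda>_. 1) = disjoint_segs m I (\<lambda>_. 1)"
      "disjoint_segs m J' (\<lambda>_. 1) = disjoint_segs m J (\<lambda>_. 1)"
      by (rule disjoint_segs_cong; simp add: I'_def J'_def)+
    then have "disjoint_segs (Suc m) I' (\<lambda>_. 1)" "disjoint_segs (Suc m) J' (\<lambda>_. 1)"
      using IJ new unfolding blocks_def disjoint_segs_Suc
      by (simp_all add: I'_def J'_def del: One_nat_def)
    moreover have "matches A B (I' r) (J' r) 1" if "r < Suc m" for r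
      using IJ that \<open>matches A B i j 1\<close>
      by (auto simp: blocks_def less_Suc_eq I'_def J'_def simp del: One_nat_def)
    ultimately have "blocks A B (Suc m) I' J' (\<lambda>_. 1)"
      unfolding blocks_def by simp
    then show False using \<open>Suc m \<notin> S\<close> by (auto simp: S_def)
  qed
  \<comment> \<open>An occurrence whose first duo contains \<open>a\<close> has all its marks within
    distance \<open>k\<close> of \<open>a\<close>.\<close>
  define U where "U = (\<Union>a\<in>MA. {a - k..a + k})"
  define NB where "NB = (\<Union>b\<in>MB. {b - 1..b})"
  \<comment> \<open>At most \<open>4 * k\<close> starting points \<open>j\<close>, \<open>k\<close>
    lengths, \<open>L\<close> selected occurrences of each word and \<open>k\<close> marks for each
    occurrence give the second summand of the bound.\<close>
  define V where "V = (\<Union>j\<in>NB. \<Union>l\<in>{1..k}. \<Union>i\<in>{i. selected L A B i j l}. {i<..i + l})"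
  have sub: "marks L k A B \<subseteq> U \<union> V"
  proof
    fix p assume "p \<in> marks L k A B"
    then obtain i j l where p: "0 < l" "l \<le> k" "selected L A B i j l" "i < p" "p \<le> i + l"
      by (auto simp: marks_def)
    \<comment> \<open>The first duo of an occurrence is itself a common duo and is therefore
      touched.\<close>
    have "matches A B i j 1"
      using p(1,3) matches_mono[of A B i j l 0 1] by (simp add: selected_def)
    then consider "{i..i + 1} \<inter> MA \<noteq> {}" | "{j..j + 1} \<inter> MB \<noteq> {}"
      using touch by blast
    then show "p \<in> U \<union> V"
    proof cases
      assume "{i..i + 1} \<inter> MA \<noteq> {}"
      then obtain a where "a \<in> MA" "i \<le> a" "a \<le> i + 1" by auto
      then have "p \<in> U" using p unfolding U_def by (intro UN_I[of a]) auto
      then show ?thesis by simp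
    next
      assume "{j..j + 1} \<inter> MB \<noteq> {}"
      then obtain b where "b \<in> MB" "j \<le> b" "b \<le> j + 1" by auto
      then have "j \<in> NB" unfolding NB_def by (intro UN_I[of b]) auto
      moreover have "l \<in> {1..k}" "i \<in> {i. selected L A B i j l}" "p \<in> {i<..i + l}" using p by auto
      ultimately have "p \<in> V" unfolding V_def by blast
      then show ?thesis by simp
    qed
  qed
  have finsel: "finite {i. selected L A B i j l}" for j l
    by (rule finite_subset[of _ "{..<length A}"]) (auto simp: selected_def matches_def)
  have finNB: "finite NB" using fin(2) unfolding NB_def by blast
  have "finite U" using fin(1) unfolding U_def by blast
  moreover have "finite V" using finNB finsel unfolding V_def by blast
  ultimately have "card (marks L k A B) \<le> card (U \<union> V)"
    using sub by (metis card_mono finite_UnI)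
  also have "\<dots> \<le> card U + card V" by (rule card_Un_le)
  also have "card U \<le> 2 * k * (2 * k + 1)"
    unfolding U_def by (rule card_UN_le_mult[OF fin(1) cards(1)]) auto
  also have "card V \<le> 2 * k * 2 * (k * (L * k))"
    unfolding V_def
  proof (rule card_UN_le_mult[OF finNB])
    show "card NB \<le> 2 * k * 2"
      unfolding NB_def by (rule card_UN_le_mult[OF fin(2) cards(2)]) auto
    fix j
    show "card (\<Union>l\<in>{1..k}. \<Union>i\<in>{i. selected L A B i j l}. {i<..i + l}) \<le> k * (L * k)"
    proof (rule card_UN_le_mult)
      fix l assume "l \<in> {1..k}"
      then show "card (\<Union>i\<in>{i. selected L A B i j l}. {i<..i + l}) \<le> L * k"
        by (intro card_UN_le_mult[OF finsel card_selected_le]) auto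
    qed auto
  qed
  finally show ?thesis by simp
qed

section \<open>The kernel strings\<close>

text \<open>All symbols are shifted by 2; the symbols 0 and 1 separate the segments in the left and in the
  right kernel string. Each kernel string also contains the isolated symbols of the other one, and
  ends with a block of the foreign separator that makes the two strings related.\<close>

primrec segments :: "nat list \<Rightarrow> nat set \<Rightarrow> nat \<Rightarrow> nat \<Rightarrow> nat list" where
  "segments A G z 0 = []"
| "segments A G z (Suc n) = segments A G z n @
     (if n \<in> G \<or> Suc n \<in> G then (A ! n + 2) # (if Suc n \<in> G then [] else [z]) else [])"

primrec spread :: "nat list \<Rightarrow> nat set \<Rightarrow> nat \<Rightarrow> nat \<Rightarrow> nat list" where
  "spread A G z 0 = []"
| "spread A G z (Suc n) = spread A G z n @ (if n \<in> G \<or> Suc n \<in> G then [A ! n + 2, z] else [])"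

definition kept :: "nat set \<Rightarrow> nat \<Rightarrow> nat" where
  "kept G n = card {p. p < n \<and> (p \<in> G \<or> Suc p \<in> G)}"

text \<open>The duos that are not inherited from the given string: they differ for \<open>z = 0\<close> and \<open>z = 1\<close>.\<close>

definition separating :: "nat \<Rightarrow> nat \<Rightarrow> nat \<Rightarrow> bool" where
  "separating z u v \<longleftrightarrow> 2 \<le> u \<and> v = z \<or> u = z \<and> 2 \<le> v \<or> u = z \<and> v = 1 - z \<or> u = 1 - z \<and> v = 1 - z"

text \<open>\<open>e\<close> places the kept positions of \<open>A\<close> in a kernel string. The
  last clause is what excludes new common duos: no pair is separating both for 0 and for 1, and no
  separating pair consists of two symbols from 2 on, as the image of a marked duo does.\<close>

definition embeds :: "nat list \<Rightarrow> nat set \<Rightarrow> nat \<Rightarrow> (nat \<Rightarrow> nat) \<Rightarrow> nat list \<Rightarrow> bool" where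
  "embeds A G z e X \<longleftrightarrow>
     (\<forall>p<length A. p \<in> G \<or> Suc p \<in> G \<longrightarrow> e p < length X \<and> X ! e p = A ! p + 2) \<and>
     (\<forall>p. Suc p \<in> G \<longrightarrow> e (Suc p) = Suc (e p)) \<and>
     inj_on e {p. p \<in> G \<or> Suc p \<in> G} \<and>
     (\<forall>x. Suc x < length X \<longrightarrow>
        (\<exists>p. Suc p \<in> G \<and> e p = x) \<or> separating z (X ! x) (X ! Suc x))"

lemma kept_Suc: "kept G (Suc n) = kept G n + (if n \<in> G \<or> Suc n \<in> G then 1 else 0)"
proof -
  have "{p. p < Suc n \<and> (p \<in> G \<or> Suc p \<in> G)} =
    (if n \<in> G \<or> Suc n \<in> G then insert n {p. p < n \<and> (p \<in> G \<or> Suc p \<in> G)}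
     else {p. p < n \<and> (p \<in> G \<or> Suc p \<in> G)})"
    by (auto simp: less_Suc_eq)
  then show ?thesis by (auto simp: kept_def)
qed

lemma kept_0 [simp]: "kept G 0 = 0"
  by (simp add: kept_def)

lemma length_segments_bounds:
  "kept G n \<le> length (segments A G z n)" "length (segments A G z n) \<le> 2 * kept G n"
  by (induction n) (auto simp: kept_Suc)

lemma length_spread: "length (spread A G z n) = 2 * kept G n"
  by (induction n) (auto simp: kept_Suc)

text \<open>The separator does not influence the symbols from 2 on, so those of
  \<open>segments A G 0 n\<close> serve as the common reference for all variants. Whatever remains
  is a number of separators.\<close>

lemma mset_segments_spread:
  "mset (segments A G y n) = mset (filter (\<lambda>v. 2 \<le> v) (segments A G 0 n)) +
     replicate_mset (length (segments A G y n) - kept G n) y"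
  "mset (spread A G z n) = mset (filter (\<lambda>v. 2 \<le> v) (segments A G 0 n)) +
     replicate_mset (kept G n) z"
  using length_segments_bounds(1)[of G _ A y]
  by (induction n) (auto simp: kept_Suc Suc_diff_le)

lemma kept_le:
  assumes "finite G" shows "kept G n \<le> 2 * card G"
proof -
  have "{p. p < n \<and> (p \<in> G \<or> Suc p \<in> G)} \<subseteq> G \<union> (\<lambda>p. p - 1) ` G" by force
  then have "kept G n \<le> card (G \<union> (\<lambda>p. p - 1) ` G)"
    unfolding kept_def using assms by (intro card_mono) auto
  also have "\<dots> \<le> card G + card G"
    using card_Un_le[of G "(\<lambda>p. p - 1) ` G"] card_image_le[OF assms, of "\<lambda>p. p - 1"] by linarith
  finally show ?thesis by simp
qed

text \<open>\<open>pre\<close> and \<open>post\<close> are the foreign material around the segments.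
  The conditions on \<open>last pre\<close> and \<open>hd post\<close> make the two junctions
  separating, also when some of the three parts are empty.\<close>

lemma embeds_segments:
  assumes G: "\<And>p. p \<in> G \<Longrightarrow> 0 < p \<and> p < length A" and z: "z \<le> 1"
    and pre: "successively (separating z) pre" "pre = [] \<or> last pre = z"
    and post: "successively (separating z) post" "post = [] \<or> 2 \<le> hd post \<or> hd post = 1 - z"
  shows "embeds A G z (\<lambda>p. length pre + length (segments A G z p))
    (pre @ segments A G z (length A) @ post)"
proof -
  define S where "S = segments A G z"
  define e where "e p = length pre + length (S p)" for p
  have S_Suc: "S (Suc n) = S n @
     (if n \<in> G \<or> Suc n \<in> G then (A ! n + 2) # (if Suc n \<in> G then [] else [z]) else [])" for n
    by (simp add: S_def)
  have S0: "S 0 = []" by (simp add: S_def)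
  have prefix: "\<exists>ys. S n = S m @ ys" if "m \<le> n" for m n
    using that
  proof (induction n)
    case (Suc n)
    then show ?case by (cases "m = Suc n") (auto simp: S_Suc)
  qed simp
  have nth: "e p < length (pre @ S n) \<and> (pre @ S n) ! e p = A ! p + 2"
    if p: "p < n" "p \<in> G \<or> Suc p \<in> G" for p n
  proof -
    obtain ys where "S n = S (Suc p) @ ys" using prefix[of "Suc p" n] p(1) by auto
    then show ?thesis using p(2) by (auto simp: e_def S_Suc nth_append)
  qed
  have step: "e (Suc p) = Suc (e p)" if "Suc p \<in> G" for p
    using that by (simp add: e_def S_Suc)
  have less: "e p < e q" if "p < q" "p \<in> G \<or> Suc p \<in> G" for p q
  proof -
    obtain ys where "S q = S (Suc p) @ ys" using prefix[of "Suc p" q] \<open>p < q\<close> by auto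
    then show ?thesis using that(2) by (auto simp: e_def S_Suc)
  qed
  then have inj: "inj_on e {p. p \<in> G \<or> Suc p \<in> G}"
    by (metis (mono_tags, lifting) inj_onI linorder_neqE_nat mem_Collect_eq nat_neq_iff)
  \<comment> \<open>The last symbol tells how position \<open>n\<close> will be attached: after a
    separator the next duo is separating, and after a proper symbol the duo ending at
    \<open>n\<close> is marked and its image starts at the end of the prefix.\<close>
  have duos: "(\<forall>x. Suc x < length (pre @ S n) \<longrightarrow>
      (\<exists>p. Suc p \<in> G \<and> e p = x) \<or> separating z ((pre @ S n) ! x) ((pre @ S n) ! Suc x)) \<and>
    (pre @ S n = [] \<or> last (pre @ S n) = z \<and> n \<notin> G \<or>
       2 \<le> last (pre @ S n) \<and> n \<in> G \<and> Suc (e (n - 1)) = length (pre @ S n))" for n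
  proof (induction n)
    case 0
    have "0 \<notin> G" using G by blast
    then show ?case using pre by (auto simp: S0 successively_conv_nth)
  next
    case (Suc n)
    define Y where "Y = pre @ S n"
    define ys where
      "ys = (if n \<in> G \<or> Suc n \<in> G then (A ! n + 2) # (if Suc n \<in> G then [] else [z]) else [])"
    have Y_Suc: "pre @ S (Suc n) = Y @ ys" by (simp add: Y_def ys_def S_Suc)
    have eY: "e n = length Y" by (simp add: e_def Y_def)
    have IH: "Suc x < length Y \<Longrightarrow> (\<exists>p. Suc p \<in> G \<and> e p = x) \<or> separating z (Y ! x) (Y ! Suc x)"
      "Y = [] \<or> last Y = z \<and> n \<notin> G \<or> 2 \<le> last Y \<and> n \<in> G \<and> Suc (e (n - 1)) = length Y" for x
      using Suc.IH by (auto simp: Y_def)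
    have "(\<exists>p. Suc p \<in> G \<and> e p = x) \<or> separating z ((Y @ ys) ! x) ((Y @ ys) ! Suc x)"
      if x: "Suc x < length (Y @ ys)" for x
    proof (cases "Suc x < length Y")
      case True
      then show ?thesis using IH(1)[of x] by (simp add: nth_append)
    next
      case F: False
      show ?thesis
      proof (cases "Suc x = length Y")
        case True
        then have "Y \<noteq> []" "x = length Y - 1" by auto
        then have Y: "Y \<noteq> []" "Y ! x = last Y" by (simp_all add: last_conv_nth)
        show ?thesis
        proof (cases "n \<in> G")
          case nG: True
          then have "0 < n" using G by blast
          have "2 \<le> last Y \<and> Suc (e (n - 1)) = length Y \<or> last Y = z \<and> False"
            using IH(2) Y(1) nG by auto
          then have "Suc (e (n - 1)) = length Y" by blast
          then show ?thesis using True nG \<open>0 < n\<close> by (intro disjI1 exI[of _ "n - 1"]) auto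
        next
          case False
          then have "last Y = z" using IH(2) Y(1) by auto
          moreover have "(Y @ ys) ! Suc x = A ! n + 2"
            using x True by (auto simp: ys_def nth_append split: if_splits)
          ultimately show ?thesis using Y True by (simp add: separating_def nth_append)
        qed
      next
        case False
        then have "x = length Y" using F x by (auto simp: ys_def split: if_splits)
        then show ?thesis using x by (auto simp: ys_def separating_def nth_append split: if_splits)
      qed
    qed
    moreover have "Y @ ys = [] \<or> last (Y @ ys) = z \<and> Suc n \<notin> G \<or>
       2 \<le> last (Y @ ys) \<and> Suc n \<in> G \<and> Suc (e n) = length (Y @ ys)"
      using IH(2) eY by (auto simp: ys_def)
    ultimately show ?case unfolding Y_Suc by simp
  qed
  define Y where "Y = pre @ S (length A)"
  \<comment> \<open>No mark lies at the end of \<open>A\<close>, so a nonempty prefix up to there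
    ends in the separator.\<close>
  have "length A \<notin> G" using G by blast
  then have lastY: "Y = [] \<or> last Y = z" using duos[of "length A"] by (auto simp: Y_def)
  have "(\<exists>p. Suc p \<in> G \<and> e p = x) \<or> separating z ((Y @ post) ! x) ((Y @ post) ! Suc x)"
    if x: "Suc x < length (Y @ post)" for x
  proof -
    consider "Suc x < length Y" | "Suc x = length Y" | "length Y \<le> x" by linarith
    then show ?thesis
    proof cases
      case 1
      then show ?thesis using duos[of "length A"] by (auto simp: Y_def[symmetric] nth_append)
    next
      case 2
      then have "Y \<noteq> []" "post \<noteq> []" using x by auto
      moreover from this have "Y ! x = last Y" "post ! 0 = hd post"
        using 2 by (auto simp: last_conv_nth hd_conv_nth simp flip: 2)
      ultimately show ?thesis using 2 lastY post(2) z by (auto simp: nth_append separating_def)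
    next
      case 3
      define y where "y = x - length Y"
      have "x = length Y + y" using 3 by (simp add: y_def)
      then show ?thesis using x post(1) by (auto simp: nth_append successively_conv_nth)
    qed
  qed
  moreover have "e p < length (Y @ post) \<and> (Y @ post) ! e p = A ! p + 2"
    if "p < length A" "p \<in> G \<or> Suc p \<in> G" for p
    using nth[OF that] by (simp add: Y_def[symmetric] nth_append)
  ultimately have "embeds A G z e (Y @ post)"
    using step inj unfolding embeds_def by blast
  then show ?thesis by (simp add: Y_def S_def e_def[abs_def])
qed

lemma successively_spread:
  "successively (separating z) (spread A G z n)"
  "spread A G z n = [] \<or> 2 \<le> hd (spread A G z n) \<and> last (spread A G z n) = z"
proof (induction n)
  case (Suc n)
  {
    case 1
    show ?case using Suc by (auto simp: successively_append_iff separating_def)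
  next
    case 2
    show ?case using Suc by (cases "spread A G z n") auto
  }
qed auto

lemma successively_replicate: "P x x \<Longrightarrow> successively P (replicate n x)"
proof (induction n)
  case (Suc n)
  then show ?case by (cases n) auto
qed simp

lemma hd_replicate_or_Nil: "replicate n x = [] \<or> hd (replicate n x) = x"
  by (cases n) auto

text \<open>The padding equals the number of separators 1 in the unpadded right string, namely its
  length minus the number of kept symbols of both strings. In the left string, 1 occurs nowhere
  else.\<close>

definition kernel_left :: "nat list \<Rightarrow> nat list \<Rightarrow> nat set \<Rightarrow> nat set \<Rightarrow> nat list" where
  "kernel_left A B G H = segments A G 0 (length A) @ spread B H 0 (length B) @
     replicate (2 * kept G (length A) + length (segments B H 1 (length B))
       - (kept G (length A) + kept H (length B))) 1"

definition kernel_right :: "nat list \<Rightarrow> nat list \<Rightarrow> nat set \<Rightarrow> nat set \<Rightarrow> nat list" where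
  "kernel_right A B G H = spread A G 1 (length A) @ segments B H 1 (length B) @
     replicate (length (segments A G 0 (length A)) + 2 * kept H (length B)
       - (kept G (length A) + kept H (length B))) 0"

lemma related_kernel: "related (kernel_left A B G H) (kernel_right A B G H)"
proof -
  define n where "n = length A"
  define n' where "n' = length B"
  \<comment> \<open>\<open>segments\<close> has at least one symbol for each kept position, so the
    truncated subtractions are exact and split into the separators of \<open>spread\<close> and
    those of \<open>segments\<close>.\<close>
  have "2 * kept G n + length (segments B H 1 n') - (kept G n + kept H n') =
      kept G n + (length (segments B H 1 n') - kept H n')"
    "length (segments A G 0 n) + 2 * kept H n' - (kept G n + kept H n') =
      kept H n' + (length (segments A G 0 n) - kept G n)"
    using length_segments_bounds(1)[where G = H and A = B and z = 1 and n = n']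
      length_segments_bounds(1)[where G = G and A = A and z = 0 and n = n] by linarith+
  moreover define K K' where "K = mset (filter (\<lambda>v. 2 \<le> v) (segments A G 0 n))"
    and "K' = mset (filter (\<lambda>v. 2 \<le> v) (segments B H 0 n'))"
  moreover have "mset (segments A G 0 n) = K + replicate_mset (length (segments A G 0 n) - kept G n) 0"
    "mset (segments B H 1 n') = K' + replicate_mset (length (segments B H 1 n') - kept H n') 1"
    "mset (spread A G 1 n) = K + replicate_mset (kept G n) 1"
    "mset (spread B H 0 n') = K' + replicate_mset (kept H n') 0"
    unfolding K_def K'_def by (rule mset_segments_spread)+
  ultimately show ?thesis
    unfolding related_def kernel_left_def kernel_right_def n_def[symmetric] n'_def[symmetric]
    by (auto simp: multiset_eq_iff)
qed

lemma length_kernel_le: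
  "length (kernel_left A B G H) \<le> 3 * (kept G (length A) + kept H (length B))"
  using length_segments_bounds[where G = G and A = A and z = 0 and n = "length A"]
    length_segments_bounds[where G = H and A = B and z = 1 and n = "length B"]
  by (simp add: kernel_left_def length_spread)

text \<open>On the left the foreign symbols follow the segments, on the right they precede them. The
  padding is attached by the duo of 0 and 1 on the left and of 1 and 0 on the right, each of which
  \<open>separating\<close> admits on its own side only.\<close>

lemma embeds_kernel:
  assumes "\<And>p. p \<in> G \<Longrightarrow> 0 < p \<and> p < length A" "\<And>p. p \<in> H \<Longrightarrow> 0 < p \<and> p < length B"
  obtains e f where "embeds A G 0 e (kernel_left A B G H)" "embeds B H 1 f (kernel_right A B G H)"
proof -
  define U where "U = replicate (2 * kept G (length A) + length (segments B H 1 (length B))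
       - (kept G (length A) + kept H (length B))) (1::nat)"
  define V where "V = replicate (length (segments A G 0 (length A)) + 2 * kept H (length B)
       - (kept G (length A) + kept H (length B))) (0::nat)"
  have UV: "successively (separating 0) U" "successively (separating 1) V"
    "U = [] \<or> hd U = 1" "V = [] \<or> hd V = 0"
    unfolding U_def V_def
    by (rule successively_replicate hd_replicate_or_Nil; simp add: separating_def)+
  have post: "successively (separating 0) (spread B H 0 (length B) @ U)"
    using UV successively_spread[where z = 0 and A = B and G = H and n = "length B"]
    by (auto simp: successively_append_iff separating_def)
  have post': "spread B H 0 (length B) @ U = [] \<or> 2 \<le> hd (spread B H 0 (length B) @ U) \<or>
      hd (spread B H 0 (length B) @ U) = 1 - 0"
    using UV successively_spread(2)[where z = 0 and A = B and G = H and n = "length B"]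
    by (cases "spread B H 0 (length B) = []") auto
  have "embeds A G 0 (\<lambda>p. length ([] :: nat list) + length (segments A G 0 p))
      ([] @ segments A G 0 (length A) @ spread B H 0 (length B) @ U)"
    by (rule embeds_segments[OF assms(1) _ _ _ post post']) auto
  moreover have "embeds B H 1 (\<lambda>p. length (spread A G 1 (length A)) + length (segments B H 1 p))
      (spread A G 1 (length A) @ segments B H 1 (length B) @ V)"
    by (rule embeds_segments[OF assms(2)]) (use UV successively_spread[where z = 1 and A = A and G = G and n = "length A"] in auto)
  ultimately show ?thesis
    using that by (simp add: kernel_left_def kernel_right_def U_def V_def)
qed

section \<open>Transport of blocks to the kernel strings and back\<close>

lemma embeds_shift:
  assumes "embeds A G z e X" "{i<..i + l} \<subseteq> G" "x \<le> l"
  shows "e (i + x) = e i + x"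
  using assms(3)
proof (induction x)
  case (Suc x)
  then have "Suc (i + x) \<in> G" using assms(2) by auto
  then have "e (Suc (i + x)) = Suc (e (i + x))" using assms(1) by (auto simp: embeds_def)
  then show ?case using Suc by simp
qed simp

lemma embeds_nth:
  assumes "embeds A G z e X" "{i<..i + l} \<subseteq> G" "x \<le> l" "0 < l" "i + l < length A"
  shows "e i + x < length X" "X ! (e i + x) = A ! (i + x) + 2"
    "i + x \<in> {p. p \<in> G \<or> Suc p \<in> G}"
proof -
  have "i + x \<in> G \<or> Suc (i + x) \<in> G" using assms(2-4) by (cases "x = 0") force+
  then show "e i + x < length X" "X ! (e i + x) = A ! (i + x) + 2"
    "i + x \<in> {p. p \<in> G \<or> Suc p \<in> G}"
    using assms(1,3,5) embeds_shift[OF assms(1-3)] unfolding embeds_def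
    by (metis add_le_cancel_left le_less_trans, metis add_le_cancel_left le_less_trans, simp)
qed

lemma disjoint_segs_embed:
  assumes e: "embeds A G z e X" and dj: "disjoint_segs m I l"
    and I: "\<And>r. r < m \<Longrightarrow> {I r<..I r + l r} \<subseteq> G \<and> 0 < l r \<and> I r + l r < length A"
  shows "disjoint_segs m (\<lambda>r. e (I r)) l"
  unfolding disjoint_segs_def
proof (intro allI impI equals0I)
  fix r s q assume rs: "r < m" "s < m" "r \<noteq> s"
    and q: "q \<in> {e (I r)..e (I r) + l r} \<inter> {e (I s)..e (I s) + l s}"
  define x y where "x = q - e (I r)" and "y = q - e (I s)"
  have xy: "x \<le> l r" "y \<le> l s" "q = e (I r) + x" "q = e (I s) + y"
    using q by (auto simp: x_def y_def)
  note Ir = I[OF rs(1)] and Is = I[OF rs(2)]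
  have "e (I r + x) = e (I s + y)"
    using xy embeds_shift[OF e, of "I r" "l r" x] embeds_shift[OF e, of "I s" "l s" y] Ir Is by simp
  moreover have "inj_on e {p. p \<in> G \<or> Suc p \<in> G}" using e by (simp add: embeds_def)
  moreover have "I r + x \<in> {p. p \<in> G \<or> Suc p \<in> G}" "I s + y \<in> {p. p \<in> G \<or> Suc p \<in> G}"
    using embeds_nth(3)[OF e, of "I r" "l r" x] embeds_nth(3)[OF e, of "I s" "l s" y] xy Ir Is
    by auto
  ultimately have "I r + x = I s + y" unfolding inj_on_def by blast
  then have "I r + x \<in> {I r..I r + l r} \<inter> {I s..I s + l s}" using xy by auto
  then show False using dj rs unfolding disjoint_segs_def by blast
qed

lemma blocks_embed:
  assumes e: "embeds A G z e X" and f: "embeds B H y f Y" and bl: "blocks A B m I J l"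
    and IJ: "\<And>r. r < m \<Longrightarrow> {I r<..I r + l r} \<subseteq> G \<and> {J r<..J r + l r} \<subseteq> H"
  shows "blocks X Y m (\<lambda>r. e (I r)) (\<lambda>r. f (J r)) l"
proof -
  have bl': "0 < l r" "I r + l r < length A" "J r + l r < length B"
    "\<And>x. x \<le> l r \<Longrightarrow> A ! (I r + x) = B ! (J r + x)" if "r < m" for r
    using bl that by (auto simp: blocks_def matches_def)
  have "matches X Y (e (I r)) (f (J r)) (l r)" if r: "r < m" for r
    using embeds_nth[OF e, of "I r" "l r"] embeds_nth[OF f, of "J r" "l r"] bl'[OF r] IJ[OF r]
    unfolding matches_def by (metis order_refl)
  moreover have "disjoint_segs m (\<lambda>r. e (I r)) l"
    by (rule disjoint_segs_embed[OF e]) (use bl bl' IJ in \<open>auto simp: blocks_def\<close>)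
  moreover have "disjoint_segs m (\<lambda>r. f (J r)) l"
    by (rule disjoint_segs_embed[OF f]) (use bl bl' IJ in \<open>auto simp: blocks_def\<close>)
  ultimately show ?thesis using bl' by (auto simp: blocks_def)
qed

text \<open>Consecutive images come from consecutive positions: the end of one marked duo and the
  start of the next have the same image, so injectivity identifies them.\<close>

lemma embeds_preimage:
  assumes e: "embeds A G z e X" and G: "\<And>p. p \<in> G \<Longrightarrow> 0 < p \<and> p < length A" and l: "0 < l"
    and duos: "\<And>x. x < l \<Longrightarrow> \<exists>p. Suc p \<in> G \<and> e p = i + x"
  shows "\<exists>p. e p = i \<and> {p<..p + l} \<subseteq> G \<and> p + l < length A"
proof -
  have inj: "inj_on e {p. p \<in> G \<or> Suc p \<in> G}"
    and step: "\<And>p. Suc p \<in> G \<Longrightarrow> e (Suc p) = Suc (e p)"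
    using e by (auto simp: embeds_def)
  obtain p where p: "Suc p \<in> G" "e p = i" using duos[of 0] l by auto
  have "Suc (p + x) \<in> G \<and> e (p + x) = i + x" if "x < l" for x
    using that
  proof (induction x)
    case (Suc x)
    then have IH: "Suc (p + x) \<in> G" "e (p + x) = i + x" by auto
    obtain q where q: "Suc q \<in> G" "e q = i + Suc x" using duos Suc.prems by blast
    moreover have "e (Suc (p + x)) = i + Suc x" using IH step by simp
    ultimately have "q = Suc (p + x)" using inj IH(1) by (auto simp: inj_on_def)
    then show ?case using q by simp
  qed (use p in simp)
  then have *: "Suc (p + x) \<in> G" if "x < l" for x using that by blast
  have "{p<..p + l} \<subseteq> G"
  proof
    fix q assume "q \<in> {p<..p + l}"
    then show "q \<in> G" using *[of "q - Suc p"] by auto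
  qed
  moreover have "p + l < length A" using *[of "l - 1"] l G by fastforce
  ultimately show ?thesis using p(2) by blast
qed

text \<open>Every duo of a block occurs in both kernel strings. It cannot be separating for both
  separators, and if it is the image of a marked duo on one side, its symbols are too large to be
  separating on the other. So it is an image on both sides, and whole blocks can be pulled
  back.\<close>

lemma blocks_unembed:
  assumes e: "embeds A G 0 e X" and f: "embeds B H 1 f Y" and bl: "blocks X Y m I J l"
    and G: "\<And>p. p \<in> G \<Longrightarrow> 0 < p \<and> p < length A" and H: "\<And>p. p \<in> H \<Longrightarrow> 0 < p \<and> p < length B"
  obtains I' J' where "blocks A B m I' J' l"
proof -
  have large: "2 \<le> X ! e p" "2 \<le> X ! Suc (e p)" if "Suc p \<in> G" for p
    using e that G[of "Suc p"] unfolding embeds_def by (metis Suc_lessD le_add2)+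
  have large': "2 \<le> Y ! f p" "2 \<le> Y ! Suc (f p)" if "Suc p \<in> H" for p
    using f that H[of "Suc p"] unfolding embeds_def by (metis Suc_lessD le_add2)+
  have ex: "\<exists>p q. e p = I r \<and> {p<..p + l r} \<subseteq> G \<and> p + l r < length A \<and>
      f q = J r \<and> {q<..q + l r} \<subseteq> H \<and> q + l r < length B" if r: "r < m" for r
  proof -
    have l: "0 < l r" and len: "I r + l r < length X" "J r + l r < length Y"
      and eq: "\<And>x. x \<le> l r \<Longrightarrow> X ! (I r + x) = Y ! (J r + x)"
      using bl r by (auto simp: blocks_def matches_def)
    have "(\<exists>p. Suc p \<in> G \<and> e p = I r + x) \<and> (\<exists>p. Suc p \<in> H \<and> f p = J r + x)"
      if x: "x < l r" for x
    proof -
      have "Suc (I r + x) < length X" "Suc (J r + x) < length Y" using x len by auto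
      then have "(\<exists>p. Suc p \<in> G \<and> e p = I r + x) \<or>
          separating 0 (X ! (I r + x)) (X ! Suc (I r + x))"
        "(\<exists>p. Suc p \<in> H \<and> f p = J r + x) \<or>
          separating 1 (Y ! (J r + x)) (Y ! Suc (J r + x))"
        using e f unfolding embeds_def by blast+
      moreover have "X ! (I r + x) = Y ! (J r + x)" "X ! Suc (I r + x) = Y ! Suc (J r + x)"
        using eq[of x] eq[of "Suc x"] x by auto
      ultimately show ?thesis
        using large large' unfolding separating_def by fastforce
    qed
    then show ?thesis
      using embeds_preimage[OF e G l, of "I r"] embeds_preimage[OF f H l, of "J r"] by metis
  qed
  define I' J' where
    "I' r = (SOME p. e p = I r \<and> {p<..p + l r} \<subseteq> G \<and> p + l r < length A)" and
    "J' r = (SOME q. f q = J r \<and> {q<..q + l r} \<subseteq> H \<and> q + l r < length B)" for r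
  have I': "e (I' r) = I r \<and> {I' r<..I' r + l r} \<subseteq> G \<and> I' r + l r < length A" if "r < m" for r
    unfolding I'_def by (rule someI_ex) (use ex[OF that] in blast)
  have J': "f (J' r) = J r \<and> {J' r<..J' r + l r} \<subseteq> H \<and> J' r + l r < length B" if "r < m" for r
    unfolding J'_def by (rule someI_ex) (use ex[OF that] in blast)
  have pos: "0 < l r" if "r < m" for r using bl that by (simp add: blocks_def)
  \<comment> \<open>Stated for an arbitrary embedding, to serve both for \<open>A\<close> and for
    \<open>B\<close>: a common position of two segments would have a common image.\<close>
  have dj: "disjoint_segs m P l"
    if "disjoint_segs m Q l" "embeds C K y h Z"
      "\<And>r. r < m \<Longrightarrow> h (P r) = Q r \<and> {P r<..P r + l r} \<subseteq> K" for P Q C K y h Z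
    unfolding disjoint_segs_def
  proof (intro allI impI equals0I)
    fix r s q assume rs: "r < m" "s < m" "r \<noteq> s"
      and q: "q \<in> {P r..P r + l r} \<inter> {P s..P s + l s}"
    have "h q = Q r + (q - P r)" "h q = Q s + (q - P s)"
      using q that(3)[OF rs(1)] that(3)[OF rs(2)] embeds_shift[OF that(2), of "P r" "l r" "q - P r"]
        embeds_shift[OF that(2), of "P s" "l s" "q - P s"] by auto
    then have "h q \<in> {Q r..Q r + l r} \<inter> {Q s..Q s + l s}" using q by auto
    then show False using that(1) rs unfolding disjoint_segs_def by blast
  qed
  have "matches A B (I' r) (J' r) (l r)" if r: "r < m" for r
  proof -
    have "X ! (I r + x) = Y ! (J r + x)" if "x \<le> l r" for x
      using bl r that by (auto simp: blocks_def matches_def)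
    then have "A ! (I' r + x) = B ! (J' r + x)" if "x \<le> l r" for x
      using embeds_nth(2)[OF e, of "I' r" "l r" x] embeds_nth(2)[OF f, of "J' r" "l r" x]
        I'[OF r] J'[OF r] pos[OF r] that by simp
    then show ?thesis using I'[OF r] J'[OF r] by (simp add: matches_def)
  qed
  moreover have "disjoint_segs m I' l" "disjoint_segs m J' l"
    by (rule dj[OF _ e], use bl I' in \<open>auto simp: blocks_def\<close>)
      (rule dj[OF _ f], use bl J' in \<open>auto simp: blocks_def\<close>)
  ultimately show ?thesis using that pos by (auto simp: blocks_def)
qed

text \<open>The bound on \<open>L\<close> serves the direction from the given strings to the kernel,
  where blocks must first be moved into the marks. In the other direction the shape of the kernel
  strings suffices.\<close>

lemma max_duo_psm_kernel:
  assumes "related A B" "2 * k * (k + 1) < L"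
  shows "max_duo_psm (kernel_left A B (marks L k A B) (marks L k B A))
      (kernel_right A B (marks L k A B) (marks L k B A)) k \<longleftrightarrow> max_duo_psm A B k"
    (is "max_duo_psm ?X ?Y k \<longleftrightarrow> _")
proof -
  obtain e f where ef: "embeds A (marks L k A B) 0 e ?X" "embeds B (marks L k B A) 1 f ?Y"
    using embeds_kernel[OF marks_bounds marks_bounds] .
  show ?thesis
  proof
    assume "max_duo_psm ?X ?Y k"
    then obtain m I J l where bl: "blocks ?X ?Y m I J l" "(\<Sum>r<m. l r) = k"
      by (rule max_duo_psm_blocks_elim)
    obtain I' J' where "blocks A B m I' J' l"
      using blocks_unembed[OF ef bl(1) marks_bounds marks_bounds] .
    then show "max_duo_psm A B k"
      using max_duo_psm_blocks_intro[OF assms(1)] bl(2) by blast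
  next
    assume "max_duo_psm A B k"
    then obtain m I J l where bl: "blocks A B m I J l" "(\<Sum>r<m. l r) = k"
      by (rule max_duo_psm_blocks_elim)
    obtain I' J' where IJ: "blocks A B m I' J' l" "\<forall>r<m. {I' r<..I' r + l r} \<subseteq> marks L k A B \<and>
        {J' r<..J' r + l r} \<subseteq> marks L k B A"
      using blocks_in_marks[OF bl assms(2)] by blast
    have "blocks ?X ?Y m (\<lambda>r. e (I' r)) (\<lambda>r. f (J' r)) l"
      by (rule blocks_embed[OF ef IJ(1)]) (use IJ(2) in blast)
    then show "max_duo_psm ?X ?Y k"
      using max_duo_psm_blocks_intro[OF related_kernel] bl(2) by blast
  qed
qed

section \<open>The size of the kernel\<close>

lemma finite_marks: "finite (marks L k A B)"
  by (rule finite_subset[of _ "{..<length A}"]) (auto dest: marks_bounds)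

text \<open>With \<open>L = 5 * k * k\<close> there are at most
  \<open>4 * k ^ 2 + 2 * k + 20 * k ^ 5\<close> marks in each string, hence at most
  \<open>26 * k ^ 6\<close>. A mark keeps at most two positions, there are two strings, and a kept
  position accounts for at most three symbols: \<open>3 * 2 * 2 * 26 = 312\<close>.\<close>

lemma length_kernel_bound:
  assumes "related A B" "\<not> max_duo_psm A B k"
  shows "length (kernel_left A B (marks (5 * k * k) k A B) (marks (5 * k * k) k B A)) \<le> 312 * k ^ 6"
proof (cases "k = 0")
  case True
  then have "marks L k C D = {}" for L and C D :: "nat list" by (auto simp: marks_def)
  then show ?thesis
    using length_kernel_le[of A B "{}" "{}"] True by (simp add: kept_def)
next
  case False
  have no: "(\<Sum>r<m. l r) < k" if "blocks A B m I J l" for m I J l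
    using max_duo_psm_blocks_intro[OF assms(1) that] assms(2) not_less by blast
  have no': "(\<Sum>r<m. l r) < k" if "blocks B A m I J l" for m I J l
    using no that blocks_sym by blast
  have "2 * k * (2 * k + 1) + 2 * k * 2 * (k * (5 * k * k * k)) \<le> 26 * k ^ 6"
  proof -
    have pow: "k ^ a \<le> k ^ 6" if "a \<le> 6" for a using False that by (simp add: power_increasing)
    have "2 * k * (2 * k + 1) + 2 * k * 2 * (k * (5 * k * k * k)) = 4 * k ^ 2 + 2 * k ^ 1 + 20 * k ^ 5"
      by (simp add: algebra_simps power_numeral_reduce)
    then show ?thesis using pow[of 2] pow[of 1] pow[of 5] by linarith
  qed
  moreover have "card (marks (5 * k * k) k A B) \<le> 2 * k * (2 * k + 1) + 2 * k * 2 * (k * (5 * k * k * k))"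
    by (rule card_marks_le) (rule no)
  moreover have "card (marks (5 * k * k) k B A) \<le> 2 * k * (2 * k + 1) + 2 * k * 2 * (k * (5 * k * k * k))"
    by (rule card_marks_le) (rule no')
  ultimately have cards: "card (marks (5 * k * k) k A B) \<le> 26 * k ^ 6" "card (marks (5 * k * k) k B A) \<le> 26 * k ^ 6"
    by linarith+
  have kept_marks: "kept (marks L k C D) n \<le> 2 * card (marks L k C D)"
    for L n and C D :: "nat list"
    by (rule kept_le[OF finite_marks])
  have arith: "x \<le> 3 * (u + v) \<Longrightarrow> u \<le> 2 * c \<Longrightarrow> v \<le> 2 * d \<Longrightarrow> c \<le> 26 * y \<Longrightarrow> d \<le> 26 * y \<Longrightarrow>
      x \<le> 312 * y" for x u v c d y :: nat
    by simp
  show ?thesis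
    by (rule arith[OF length_kernel_le kept_marks kept_marks cards])
qed

section \<open>Running programs\<close>

text \<open>A Hoare triple for total correctness with a time bound, taken at one given start
  store.\<close>

definition run :: "com \<Rightarrow> store \<Rightarrow> nat \<Rightarrow> (store \<Rightarrow> bool) \<Rightarrow> bool" where
  "run c s T Q \<longleftrightarrow> (\<exists>t s'. exec c s t s' \<and> t \<le> T \<and> Q s')"

primrec wregs :: "com \<Rightarrow> nat set" where
  "wregs Skip = {}"
| "wregs (SetReg x e) = {x}"
| "wregs (SetCell a i e) = {}"
| "wregs (Seq c1 c2) = wregs c1 \<union> wregs c2"
| "wregs (Cond b c1 c2) = wregs c1 \<union> wregs c2"
| "wregs (While b c) = wregs c"

primrec warrs :: "com \<Rightarrow> nat set" where
  "warrs Skip = {}"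
| "warrs (SetReg x e) = {}"
| "warrs (SetCell a i e) = {a}"
| "warrs (Seq c1 c2) = warrs c1 \<union> warrs c2"
| "warrs (Cond b c1 c2) = warrs c1 \<union> warrs c2"
| "warrs (While b c) = warrs c"

definition agree :: "nat set \<Rightarrow> nat set \<Rightarrow> store \<Rightarrow> store \<Rightarrow> bool" where
  "agree W V s s' \<longleftrightarrow>
     (\<forall>x. x \<notin> W \<longrightarrow> reg s' x = reg s x) \<and> (\<forall>a. a \<notin> V \<longrightarrow> arr s' a = arr s a)"

lemma agree_mono: "agree W V s s' \<Longrightarrow> W \<subseteq> W' \<Longrightarrow> V \<subseteq> V' \<Longrightarrow> agree W' V' s s'"
  unfolding agree_def by blast

text \<open>The frame property, read off the syntax. The rules below hand it to their premises, so
  postconditions mention only what a program is meant to change.\<close>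

lemma exec_agree: "exec c s t s' \<Longrightarrow> agree (wregs c) (warrs c) s s'"
  by (induction rule: exec.induct) (auto simp: agree_def)

lemma run_conseq:
  assumes "run c s T Q" "T \<le> T'"
    "\<And>s'. agree (wregs c) (warrs c) s s' \<Longrightarrow> Q s' \<Longrightarrow> Q' s'"
  shows "run c s T' Q'"
  using assms exec_agree unfolding run_def by (meson order_trans)

lemma run_Skip: "Q s \<Longrightarrow> 1 \<le> T \<Longrightarrow> run Skip s T Q"
  unfolding run_def using exec.Skip by blast

lemma run_SetReg:
  "Q (s\<lparr>reg := (reg s)(x := aval e s)\<rparr>) \<Longrightarrow> 1 \<le> T \<Longrightarrow> run (SetReg x e) s T Q"
  unfolding run_def using exec.SetReg by blast

lemma run_SetCell:
  "Q (s\<lparr>arr := (arr s)(a := (arr s a)(aval i s := aval e s))\<rparr>) \<Longrightarrow> 1 \<le> T \<Longrightarrow>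
     run (SetCell a i e) s T Q"
  unfolding run_def using exec.SetCell by blast

lemma run_Seq:
  assumes "run c1 s T1 P"
    "\<And>s'. agree (wregs c1) (warrs c1) s s' \<Longrightarrow> P s' \<Longrightarrow> run c2 s' T2 Q" "T1 + T2 \<le> T"
  shows "run (Seq c1 c2) s T Q"
proof -
  obtain t1 s1 where 1: "exec c1 s t1 s1" "t1 \<le> T1" "P s1"
    using assms(1) by (auto simp: run_def)
  obtain t2 s2 where 2: "exec c2 s1 t2 s2" "t2 \<le> T2" "Q s2"
    using assms(2)[OF exec_agree[OF 1(1)] 1(3)] by (auto simp: run_def)
  have "exec (Seq c1 c2) s (t1 + t2) s2" using 1(1) 2(1) by (rule exec.Seq)
  moreover have "t1 + t2 \<le> T" using 1 2 assms(3) by linarith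
  ultimately show ?thesis using 2(3) unfolding run_def by blast
qed

lemma run_SetReg_Seq:
  assumes "run c (s\<lparr>reg := (reg s)(x := aval e s)\<rparr>) T Q" "Suc T \<le> T'"
  shows "run (Seq (SetReg x e) c) s T' Q"
  using assms by (intro run_Seq[where P = "\<lambda>s'. s' = s\<lparr>reg := (reg s)(x := aval e s)\<rparr>" and ?T1.0 = 1])
    (auto intro: run_SetReg)

lemma run_Cond:
  assumes "bval b s \<Longrightarrow> run c1 s T Q" "\<not> bval b s \<Longrightarrow> run c2 s T Q" "1 + T \<le> T'"
  shows "run (Cond b c1 c2) s T' Q"
proof (cases "bval b s")
  case True
  then obtain t s' where "exec c1 s t s'" "t \<le> T" "Q s'" using assms(1) by (auto simp: run_def)
  then show ?thesis
    using exec.CondTrue[OF True] assms(3) unfolding run_def by (meson add_left_mono order_trans)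
next
  case False
  then obtain t s' where "exec c2 s t s'" "t \<le> T" "Q s'" using assms(2) by (auto simp: run_def)
  then show ?thesis
    using exec.CondFalse[OF False] assms(3) unfolding run_def by (meson add_left_mono order_trans)
qed

definition For :: "nat \<Rightarrow> nat \<Rightarrow> com \<Rightarrow> com" where
  "For x e c = Seq (SetReg x (Const 0))
     (While (Less (Reg x) (Reg e)) (Seq c (SetReg x (Plus (Reg x) (Const 1)))))"

lemma wregs_For [simp]: "wregs (For x e c) = insert x (wregs c)"
  by (auto simp: For_def)

lemma warrs_For [simp]: "warrs (For x e c) = warrs c"
  by (auto simp: For_def)

text \<open>Each round pays 2 for test and increment, and the final 2 covers initialization and last
  test. The bound register is reread in every test and so must not be written by the body. The
  premise \<open>inv\<close> carries the invariant over the increment, which comes after the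
  body.\<close>

lemma run_For:
  assumes fresh: "x \<notin> wregs c" "e \<notin> wregs c" "x \<noteq> e" and I0: "I 0 s"
    and step: "\<And>i s'. i < reg s e \<Longrightarrow> agree (insert x (wregs c)) (warrs c) s s' \<Longrightarrow>
      reg s' x = i \<Longrightarrow> I i s' \<Longrightarrow> run c s' T (I (Suc i))"
    and inv: "\<And>i s v. I i s \<Longrightarrow> I i (s\<lparr>reg := (reg s)(x := v)\<rparr>)"
    and T': "reg s e * (T + 2) + 2 \<le> T'"
  shows "run (For x e c) s T' (I (reg s e))"
proof -
  let ?N = "reg s e" and ?W = "insert x (wregs c)"
  let ?loop = "While (Less (Reg x) (Reg e)) (Seq c (SetReg x (Plus (Reg x) (Const 1))))"
  have loop: "run ?loop s' ((?N - i) * (T + 2) + 1) (I ?N)"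
    if "i \<le> ?N" "agree ?W (warrs c) s s'" "reg s' x = i" "I i s'" for i s'
    using that
  proof (induction "?N - i" arbitrary: i s')
    case 0
    then have "i = ?N" "reg s' e = ?N" using fresh by (auto simp: agree_def)
    moreover from this have "exec ?loop s' 1 s'" using 0 by (intro exec.WhileFalse) simp
    ultimately show ?case using 0 unfolding run_def by auto
  next
    case (Suc d)
    then have i: "i < ?N" "reg s' e = ?N" using fresh by (auto simp: agree_def)
    obtain t1 s1 where 1: "exec c s' t1 s1" "t1 \<le> T" "I (Suc i) s1"
      using step[OF i(1) Suc.prems(2-4)] by (auto simp: run_def)
    have ag: "agree (wregs c) (warrs c) s' s1" using 1(1) by (rule exec_agree)
    define s2 where "s2 = s1\<lparr>reg := (reg s1)(x := Suc i)\<rparr>"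
    have "reg s1 x = i" using ag fresh Suc.prems(3) by (simp add: agree_def)
    then have "aval (Plus (Reg x) (Const 1)) s1 = Suc i" by simp
    then have "exec (SetReg x (Plus (Reg x) (Const 1))) s1 1 s2"
      using exec.SetReg[of x "Plus (Reg x) (Const 1)" s1] unfolding s2_def by simp
    with 1(1) have body: "exec (Seq c (SetReg x (Plus (Reg x) (Const 1)))) s' (t1 + 1) s2"
      by (rule exec.Seq)
    have "agree ?W (warrs c) s s2"
      using ag Suc.prems(2) by (auto simp: agree_def s2_def)
    moreover have "I (Suc i) s2" unfolding s2_def using 1(3) by (rule inv)
    ultimately have "run ?loop s2 ((?N - Suc i) * (T + 2) + 1) (I ?N)"
      using Suc.hyps(2) i(1) by (intro Suc.hyps(1)) (auto simp: s2_def)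
    then obtain t2 s3 where 2: "exec ?loop s2 t2 s3" "t2 \<le> (?N - Suc i) * (T + 2) + 1" "I ?N s3"
      by (auto simp: run_def)
    have "exec ?loop s' (1 + (t1 + 1) + t2) s3"
      using i Suc.prems(3) by (intro exec.WhileTrue[OF _ body 2(1)]) simp
    moreover have "?N - i = Suc (?N - Suc i)" using i(1) by simp
    then have "1 + (t1 + 1) + t2 \<le> (?N - i) * (T + 2) + 1" using 1(2) 2(2) by simp
    ultimately show ?case using 2(3) unfolding run_def by blast
  qed
  have "run ?loop (s\<lparr>reg := (reg s)(x := 0)\<rparr>) (?N * (T + 2) + 1) (I ?N)"
    using loop[of 0 "s\<lparr>reg := (reg s)(x := 0)\<rparr>"] I0 inv by (simp add: agree_def)
  then show ?thesis
    unfolding For_def using T'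
    by (intro run_Seq[where P = "\<lambda>s'. s' = s\<lparr>reg := (reg s)(x := 0)\<rparr>" and ?T1.0 = 1])
      (auto intro!: run_SetReg)
qed

definition stores :: "store \<Rightarrow> nat \<Rightarrow> nat list \<Rightarrow> bool" where
  "stores s a xs \<longleftrightarrow> (\<forall>i<length xs. arr s a i = xs ! i)"

text \<open>A list under construction: register \<open>p\<close> holds the index of the next free
  cell.\<close>

definition contents :: "store \<Rightarrow> nat \<Rightarrow> nat \<Rightarrow> nat list \<Rightarrow> bool" where
  "contents s a p xs \<longleftrightarrow> reg s p = length xs \<and> stores s a xs"

text \<open>Sets are stored as the nonzero cells of an array, so the initial store holds the empty
  set in every array other than the two inputs.\<close>

definition support :: "store \<Rightarrow> nat \<Rightarrow> nat set" where
  "support s h = {p. arr s h p \<noteq> 0}"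

section \<open>The kernelization program\<close>

text \<open>Register 0 contains the common length of the strings, register 2 the parameter, register 3
  the number of occurrences selected for each word, register 4 the size bound. Words are given by
  their positions in registers 5 and 6 and their number of duos in register 7. Arrays 2 and 3
  contain the marks, arrays 4 and 5 the kernel strings, whose lengths are in registers 13 and 14;
  register 15 counts the kept positions.\<close>

definition match_com :: "nat \<Rightarrow> nat \<Rightarrow> com" where
  "match_com a b = Seq (SetReg 10 (Const 0))
     (Cond (Conj (Less (Plus (Reg 5) (Reg 7)) (Reg 0)) (Less (Plus (Reg 6) (Reg 7)) (Reg 0)))
       (Seq (SetReg 10 (Const 1))
       (Seq (SetReg 9 (Plus (Reg 7) (Const 1)))
         (For 8 9 (Cond (Equal (Cell a (Plus (Reg 5) (Reg 8))) (Cell b (Plus (Reg 6) (Reg 8))))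
           Skip (SetReg 10 (Const 0))))))
       Skip)"

lemma w_match_com [simp]: "wregs (match_com a b) = {8, 9, 10}" "warrs (match_com a b) = {}"
  by (auto simp: match_com_def)

lemma run_match_com:
  assumes n: "reg s 0 = length A" "length B = length A" and st: "stores s a A" "stores s b B"
    and ijl: "reg s 5 = i" "reg s 6 = j" "reg s 7 = l" and T: "4 * l + 10 \<le> T"
  shows "run (match_com a b) s T (\<lambda>s'. reg s' 10 = (if matches A B i j l then 1 else 0))"
    (is "run _ _ _ ?Q")
proof -
  let ?eq = "\<lambda>x. A ! (i + x) = B ! (j + x)"
  let ?test = "Cond (Equal (Cell a (Plus (Reg 5) (Reg 8))) (Cell b (Plus (Reg 6) (Reg 8))))
      Skip (SetReg 10 (Const 0))"
  let ?bounds = "Conj (Less (Plus (Reg 5) (Reg 7)) (Reg 0)) (Less (Plus (Reg 6) (Reg 7)) (Reg 0))"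
  define s1 where "s1 = s\<lparr>reg := (reg s)(10 := 0)\<rparr>"
  define s2 where "s2 = s\<lparr>reg := (reg s)(10 := 1, 9 := Suc l)\<rparr>"
  have loop: "run (For 8 9 ?test) s2 (4 * l + 6) ?Q" if len: "i + l < length A" "j + l < length A"
  proof -
    have regs: "reg s2 5 = i" "reg s2 6 = j" "reg s2 9 = Suc l" "reg s2 10 = 1"
      "stores s2 a A" "stores s2 b B"
      using n st ijl by (auto simp: s2_def stores_def)
    \<comment> \<open>The flag records whether all comparisons so far succeeded. The loop has no
      early exit, so all \<open>l + 1\<close> comparisons are charged.\<close>
    let ?I = "\<lambda>x s'. reg s' 10 = (if \<forall>y<x. ?eq y then 1 else 0)"
    have "run (For 8 9 ?test) s2 (4 * l + 6) (?I (reg s2 9))"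
    proof (rule run_For[where T = 2])
      fix x s3
      assume s3: "x < reg s2 9" "reg s3 8 = x" "?I x s3"
        "agree (insert 8 (wregs ?test)) (warrs ?test) s2 s3"
      have "arr s3 a (i + x) = A ! (i + x)" "arr s3 b (j + x) = B ! (j + x)"
        using s3(1,4) regs len n(2) by (auto simp: agree_def stores_def)
      moreover have "reg s3 5 = i" "reg s3 6 = j" using s3(4) regs by (auto simp: agree_def)
      ultimately show "run ?test s3 2 (?I (Suc x))"
        using s3(2,3) by (intro run_Cond[where T = 1] run_Skip run_SetReg) (auto simp: less_Suc_eq)
    qed (use regs in auto)
    then show ?thesis
      by (rule run_conseq) (use len n(2) in \<open>auto simp: regs matches_def less_Suc_eq_le\<close>)
  qed
  have "run (Seq (SetReg 10 (Const 1)) (Seq (SetReg 9 (Plus (Reg 7) (Const 1))) (For 8 9 ?test)))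
      s1 (4 * l + 8) ?Q" if "i + l < length A" "j + l < length A"
    using loop[OF that] ijl
    by (intro run_SetReg_Seq[where T = "4 * l + 7"] run_SetReg_Seq[where T = "4 * l + 6"])
      (simp_all add: s1_def s2_def)
  moreover have "run Skip s1 (4 * l + 8) ?Q" if "\<not> (i + l < length A \<and> j + l < length A)"
    using that n(2) by (intro run_Skip) (auto simp: s1_def matches_def)
  ultimately have "run (Cond ?bounds
      (Seq (SetReg 10 (Const 1)) (Seq (SetReg 9 (Plus (Reg 7) (Const 1))) (For 8 9 ?test))) Skip)
      s1 (4 * l + 9) ?Q"
    using n ijl by (intro run_Cond[where T = "4 * l + 8"]) (auto simp: s1_def)
  then show ?thesis
    unfolding match_com_def using T by (intro run_SetReg_Seq) (simp add: s1_def, linarith)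
qed

text \<open>The summand 1 in the address is there because a duo is represented by its second
  position.\<close>

definition mark_com :: "nat \<Rightarrow> com" where
  "mark_com h = For 8 7 (SetCell h (Plus (Plus (Reg 5) (Reg 8)) (Const 1)) (Const 1))"

lemma w_mark_com [simp]: "wregs (mark_com h) = {8}" "warrs (mark_com h) = {h}"
  by (auto simp: mark_com_def)

lemma run_mark_com:
  assumes "reg s 5 = i" "reg s 7 = l" "3 * l + 2 \<le> T"
  shows "run (mark_com h) s T (\<lambda>s'. support s' h = support s h \<union> {i<..i + l})"
proof -
  let ?I = "\<lambda>x s'. support s' h = support s h \<union> {i<..i + x}"
  have "run (mark_com h) s T (?I (reg s 7))"
    unfolding mark_com_def
  proof (rule run_For[where T = 1])
    fix x s'
    assume s': "reg s' 8 = x" "?I x s'"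
      "agree (insert 8 (wregs (SetCell h (Plus (Plus (Reg 5) (Reg 8)) (Const 1)) (Const 1))))
         (warrs (SetCell h (Plus (Plus (Reg 5) (Reg 8)) (Const 1)) (Const 1))) s s'"
    have "{i<..i + Suc x} = insert (Suc (i + x)) {i<..i + x}" by auto
    then show "run (SetCell h (Plus (Plus (Reg 5) (Reg 8)) (Const 1)) (Const 1)) s' 1 (?I (Suc x))"
      using s' assms(1) by (intro run_SetCell) (auto simp: support_def agree_def)
  qed (use assms in \<open>auto simp: support_def\<close>)
  then show ?thesis using assms(2) by simp
qed

definition occurrences_com :: "nat \<Rightarrow> nat \<Rightarrow> nat \<Rightarrow> com" where
  "occurrences_com a b h = Seq (SetReg 12 (Const 0))
     (For 5 0 (Seq (match_com a b)
       (Cond (Conj (Equal (Reg 10) (Const 1)) (Less (Reg 12) (Reg 3)))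
         (Seq (SetReg 12 (Plus (Reg 12) (Const 1))) (mark_com h))
         Skip)))"

lemma w_occurrences_com [simp]:
  "wregs (occurrences_com a b h) = {5, 8, 9, 10, 12}" "warrs (occurrences_com a b h) = {h}"
  by (auto simp: occurrences_com_def)

definition word_marks :: "nat \<Rightarrow> 'a list \<Rightarrow> 'a list \<Rightarrow> nat \<Rightarrow> nat \<Rightarrow> nat set" where
  "word_marks L A B j l = (\<Union>i\<in>{i. selected L A B i j l}. {i<..i + l})"

text \<open>The counter stops at \<open>L\<close>, hence the minimum in the invariant. Comparing it
  with \<open>L\<close> is still the same as comparing the true number of earlier occurrences, which
  is the test in \<open>selected\<close>.\<close>

lemma run_occurrences_com:
  assumes n: "reg s 0 = length A" "length B = length A" and st: "stores s a A" "stores s b B"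
    and h: "h \<noteq> a" "h \<noteq> b" and jl: "reg s 6 = j" "reg s 7 = l" and L: "reg s 3 = L"
    and T: "length A * (7 * l + 16) + 3 \<le> T"
  shows "run (occurrences_com a b h) s T
    (\<lambda>s'. support s' h = support s h \<union> word_marks L A B j l)"
proof -
  let ?hits = "\<lambda>i. {i'. i' < i \<and> matches A B i' j l}"
  let ?I = "\<lambda>i s'. reg s' 12 = min L (card (?hits i)) \<and>
    support s' h = support s h \<union> (\<Union>i'\<in>{i'. i' < i \<and> selected L A B i' j l}. {i'<..i' + l})"
  let ?mark = "Seq (SetReg 12 (Plus (Reg 12) (Const 1))) (mark_com h)"
  let ?cond = "Cond (Conj (Equal (Reg 10) (Const 1)) (Less (Reg 12) (Reg 3))) ?mark Skip"
  let ?body = "Seq (match_com a b) ?cond"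
  have hits_Suc: "?hits (Suc i) = (if matches A B i j l then insert i (?hits i) else ?hits i)" for i
    by (auto simp: less_Suc_eq)
  have card_hits: "card (?hits (Suc i)) = card (?hits i) + (if matches A B i j l then 1 else 0)" for i
    unfolding hits_Suc by simp
  have marked_Suc: "(\<Union>i'\<in>{i'. i' < Suc i \<and> selected L A B i' j l}. {i'<..i' + l}) =
      (\<Union>i'\<in>{i'. i' < i \<and> selected L A B i' j l}. {i'<..i' + l}) \<union>
      (if matches A B i j l \<and> card (?hits i) < L then {i<..i + l} else {})" for i
  proof -
    have "selected L A B i j l \<longleftrightarrow> matches A B i j l \<and> card (?hits i) < L"
      by (simp add: selected_def)
    then show ?thesis by (auto simp: less_Suc_eq)
  qed
  have step: "run ?body s1 (7 * l + 14) (?I (Suc i))"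
    if i: "i < reg s 0" and ag: "agree (insert 5 (wregs ?body)) (warrs ?body) s0 s1"
      and s0: "s0 = s\<lparr>reg := (reg s)(12 := 0)\<rparr>" and s1: "reg s1 5 = i" "?I i s1" for i s0 s1
  proof (rule run_Seq[where P = "\<lambda>s'. reg s' 10 = (if matches A B i j l then 1 else 0)"
        and ?T1.0 = "4 * l + 10" and ?T2.0 = "3 * l + 4"])
    show "run (match_com a b) s1 (4 * l + 10) (\<lambda>s'. reg s' 10 = (if matches A B i j l then 1 else 0))"
      by (rule run_match_com) (use ag s0 s1 n st h jl in \<open>auto simp: agree_def stores_def\<close>)
    fix s2 assume s2: "agree (wregs (match_com a b)) (warrs (match_com a b)) s1 s2"
      "reg s2 10 = (if matches A B i j l then 1 else 0)"
    have regs: "reg s2 12 = min L (card (?hits i))" "reg s2 3 = L" "reg s2 5 = i" "reg s2 7 = l"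
      "support s2 h = support s1 h"
      using s2 s1 ag s0 L jl by (auto simp: agree_def support_def)
    show "run ?cond s2 (3 * l + 4) (?I (Suc i))"
    proof (rule run_Cond[where T = "3 * l + 3"])
      assume "bval (Conj (Equal (Reg 10) (Const 1)) (Less (Reg 12) (Reg 3))) s2"
      then have tests: "reg s2 10 = 1" "min L (card (?hits i)) < L" using regs(1,2) by simp_all
      have m: "matches A B i j l"
        using tests(1) s2(2) by (cases "matches A B i j l") simp_all
      have c: "card (?hits i) < L"
        using tests(2) by (simp add: min_less_iff_disj)
      show "run ?mark s2 (3 * l + 3) (?I (Suc i))"
      proof (rule run_SetReg_Seq[where T = "3 * l + 2"])
        define s3 where "s3 = s2\<lparr>reg := (reg s2)(12 := aval (Plus (Reg 12) (Const 1)) s2)\<rparr>"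
        have s3: "agree {12} {} s2 s3" "reg s3 12 = Suc (reg s2 12)"
          by (auto simp: s3_def agree_def)
        have "run (mark_com h) s3 (3 * l + 2) (\<lambda>s'. support s' h = support s3 h \<union> {i<..i + l})"
          by (rule run_mark_com) (use s3 regs in \<open>auto simp: agree_def\<close>)
        then show "run (mark_com h) (s2\<lparr>reg := (reg s2)(12 := aval (Plus (Reg 12) (Const 1)) s2)\<rparr>)
            (3 * l + 2) (?I (Suc i))"
          unfolding s3_def[symmetric]
        proof (rule run_conseq)
          fix s4 assume s4: "agree (wregs (mark_com h)) (warrs (mark_com h)) s3 s4"
            "support s4 h = support s3 h \<union> {i<..i + l}"
          have "support s3 h = support s1 h" using s3 regs by (auto simp: agree_def support_def)
          moreover have "reg s4 12 = Suc (card (?hits i))"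
            using s4 s3 regs(1) c by (simp add: agree_def)
          ultimately show "?I (Suc i) s4"
            unfolding card_hits marked_Suc using s4(2) s1(2) m c by auto
        qed simp
      qed simp
    next
      assume "\<not> bval (Conj (Equal (Reg 10) (Const 1)) (Less (Reg 12) (Reg 3))) s2"
      then have "\<not> (matches A B i j l \<and> card (?hits i) < L)"
        using s2(2) regs(1,2) by (cases "matches A B i j l") (simp_all add: min_less_iff_disj)
      then show "run Skip s2 (3 * l + 3) (?I (Suc i))"
        unfolding card_hits marked_Suc using regs s1(2) by (intro run_Skip) auto
    qed simp
  qed simp
  define s0 where "s0 = s\<lparr>reg := (reg s)(12 := 0)\<rparr>"
  have s00: "reg s0 0 = reg s 0" by (simp add: s0_def)
  have "run (For 5 0 ?body) s0 (length A * (7 * l + 16) + 2) (?I (reg s0 0))"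
    by (rule run_For[where T = "7 * l + 14"])
      (use step s0_def n(1) s00 in \<open>auto simp: support_def\<close>)
  then have "run (For 5 0 ?body) s0 (length A * (7 * l + 16) + 2)
      (\<lambda>s'. support s' h = support s h \<union> word_marks L A B j l)"
  proof (rule run_conseq)
    have "{i. i < length A \<and> selected L A B i j l} = {i. selected L A B i j l}"
      by (auto simp: selected_def matches_def)
    then show "support s' h = support s h \<union> word_marks L A B j l" if "?I (reg s0 0) s'" for s'
      using that s00 n(1) by (simp add: word_marks_def)
  qed simp
  then show ?thesis
    unfolding occurrences_com_def using T
    by (intro run_SetReg_Seq) (simp add: s0_def, linarith)
qed

definition marks_com :: "nat \<Rightarrow> nat \<Rightarrow> nat \<Rightarrow> com" where
  "marks_com a b h = For 6 0 (For 11 2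
     (Seq (SetReg 7 (Plus (Reg 11) (Const 1))) (occurrences_com a b h)))"

lemma w_marks_com [simp]:
  "wregs (marks_com a b h) = {5, 6, 7, 8, 9, 10, 11, 12}" "warrs (marks_com a b h) = {h}"
  by (auto simp: marks_com_def)

text \<open>Brings \<open>marks\<close> into the form of two nested loops: a match bounds
  \<open>j\<close>, and the lengths from 1 to \<open>k\<close> become \<open>Suc x\<close> for a
  counter \<open>x\<close> from 0.\<close>

lemma marks_eq_word_marks:
  "marks L k A B = (\<Union>j<length B. \<Union>x<k. word_marks L A B j (Suc x))"
proof
  show "marks L k A B \<subseteq> (\<Union>j<length B. \<Union>x<k. word_marks L A B j (Suc x))"
  proof
    fix p assume "p \<in> marks L k A B"
    then obtain i j l where p: "0 < l" "l \<le> k" "selected L A B i j l" "i < p" "p \<le> i + l"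
      by (auto simp: marks_def)
    then have "j < length B" by (auto simp: selected_def matches_def)
    moreover have "p \<in> word_marks L A B j (Suc (l - 1))" using p by (auto simp: word_marks_def)
    moreover have "l - 1 < k" using p by linarith
    ultimately show "p \<in> (\<Union>j<length B. \<Union>x<k. word_marks L A B j (Suc x))" by blast
  qed
  have "word_marks L A B j (Suc x) \<subseteq> marks L k A B" if "x < k" for j x
    unfolding word_marks_def using that by (intro UN_least selected_in_marks) auto
  then show "(\<Union>j<length B. \<Union>x<k. word_marks L A B j (Suc x)) \<subseteq> marks L k A B"
    by blast
qed

text \<open>The leading term is the product of the starting points of words, the \<open>k\<close>
  lengths, the candidate positions and the \<open>O(k)\<close> cost of comparing and marking. A word
  occurring several times is processed each time, which just repeats its marks.\<close>

lemma run_marks_com: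
  assumes n: "reg s 0 = length A" "length B = length A" and st: "stores s a A" "stores s b B"
    and h: "h \<noteq> a" "h \<noteq> b" and k: "reg s 2 = k" and L: "reg s 3 = L" and h0: "support s h = {}"
    and T: "length A * (k * (length A * (7 * k + 16) + 6) + 4) + 2 \<le> T"
  shows "run (marks_com a b h) s T (\<lambda>s'. support s' h = marks L k A B)"
proof -
  let ?body = "Seq (SetReg 7 (Plus (Reg 11) (Const 1))) (occurrences_com a b h)"
  let ?T = "length A * (7 * k + 16) + 4"
  let ?I = "\<lambda>j s'. support s' h = (\<Union>j'<j. \<Union>x<k. word_marks L A B j' (Suc x))"
  have "run (marks_com a b h) s T (?I (reg s 0))"
    unfolding marks_com_def
  proof (rule run_For[where T = "k * (?T + 2) + 2"])
    fix j s1 assume s1: "j < reg s 0" "reg s1 6 = j" "?I j s1"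
      "agree (insert 6 (wregs (For 11 2 ?body))) (warrs (For 11 2 ?body)) s s1"
    let ?J = "\<lambda>x s'. support s' h = support s1 h \<union> (\<Union>x'<x. word_marks L A B j (Suc x'))"
    have k1: "reg s1 2 = k" using s1 k by (auto simp: agree_def)
    have "run (For 11 2 ?body) s1 (k * (?T + 2) + 2) (?J (reg s1 2))"
    proof (rule run_For[where T = ?T])
      fix x s2 assume s2: "x < reg s1 2" "reg s2 11 = x" "?J x s2"
        "agree (insert 11 (wregs ?body)) (warrs ?body) s1 s2"
      show "run ?body s2 ?T (?J (Suc x))"
      proof (rule run_Seq[where P = "\<lambda>s'. reg s' 7 = Suc x" and ?T1.0 = 1])
        fix s3 assume s3: "agree (wregs (SetReg 7 (Plus (Reg 11) (Const 1))))
            (warrs (SetReg 7 (Plus (Reg 11) (Const 1)))) s2 s3" "reg s3 7 = Suc x"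
        have occ: "run (occurrences_com a b h) s3 (length A * (7 * k + 16) + 3)
            (\<lambda>s'. support s' h = support s3 h \<union> word_marks L A B j (Suc x))"
        proof (rule run_occurrences_com)
          have "7 * Suc x \<le> 7 * k" using s2(1) k1 by simp
          then show "length A * (7 * Suc x + 16) + 3 \<le> length A * (7 * k + 16) + 3"
            by (intro add_mono mult_mono) simp_all
        qed (use s1 s2 s3 n st h L in \<open>auto simp: agree_def stores_def\<close>)
        have "support s3 h = support s2 h" using s3 by (auto simp: agree_def support_def)
        then show "run (occurrences_com a b h) s3 (length A * (7 * k + 16) + 3) (?J (Suc x))"
          using s2(3) by (intro run_conseq[OF occ]) (auto simp: lessThan_Suc)
      qed (use s2 in \<open>auto intro!: run_SetReg\<close>)
    qed (auto simp: support_def k1)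
    then show "run (For 11 2 ?body) s1 (k * (?T + 2) + 2) (?I (Suc j))"
      by (rule run_conseq) (use s1(3) k1 in \<open>auto simp: lessThan_Suc\<close>)
  qed (use T n(1) h0 in \<open>auto simp: support_def algebra_simps\<close>)
  then show ?thesis using n by (simp add: marks_eq_word_marks)
qed

section \<open>Writing the kernel strings\<close>

definition push_com :: "nat \<Rightarrow> nat \<Rightarrow> aexp \<Rightarrow> com" where
  "push_com a p e = Seq (SetCell a (Reg p) e) (SetReg p (Plus (Reg p) (Const 1)))"

lemma w_push_com [simp]: "wregs (push_com a p e) = {p}" "warrs (push_com a p e) = {a}"
  by (simp_all add: push_com_def)

lemma run_push_com:
  assumes "contents s a p xs" "aval e s = v" "2 \<le> T"
  shows "run (push_com a p e) s T (\<lambda>s'. contents s' a p (xs @ [v]))"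
  unfolding push_com_def
proof (rule run_Seq[where ?T1.0 = 1 and ?T2.0 = 1
      and P = "\<lambda>s'. s' = s\<lparr>arr := (arr s)(a := (arr s a)(reg s p := v))\<rparr>"])
  show "run (SetReg p (Plus (Reg p) (Const 1))) s' 1 (\<lambda>s'. contents s' a p (xs @ [v]))"
    if "s' = s\<lparr>arr := (arr s)(a := (arr s a)(reg s p := v))\<rparr>" for s'
    using that assms(1)
    by (intro run_SetReg) (auto simp: contents_def stores_def nth_append less_Suc_eq)
qed (use assms in \<open>auto intro!: run_SetCell\<close>)

lemma contents_agree:
  "contents s a p xs \<Longrightarrow> agree W V s s' \<Longrightarrow> p \<notin> W \<Longrightarrow> a \<notin> V \<Longrightarrow> contents s' a p xs"
  by (simp add: contents_def stores_def agree_def)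

lemma stores_agree: "stores s a xs \<Longrightarrow> agree W V s s' \<Longrightarrow> a \<notin> V \<Longrightarrow> stores s' a xs"
  by (simp add: stores_def agree_def)

text \<open>A single pass over one string serves both outputs: segments with separator
  \<open>z\<close> go to \<open>oa\<close>, and the isolated symbols with the foreign separator
  \<open>1 - z\<close> go to \<open>ob\<close>. For the other string the outputs and the separators
  change roles.\<close>

definition build_com :: "nat \<Rightarrow> nat \<Rightarrow> nat \<Rightarrow> nat \<Rightarrow> nat \<Rightarrow> nat \<Rightarrow> nat \<Rightarrow> com" where
  "build_com a h z oa pa ob pb = For 5 0
     (Cond (Neg (Conj (Equal (Cell h (Reg 5)) (Const 0))
         (Equal (Cell h (Plus (Reg 5) (Const 1))) (Const 0))))
       (Seq (push_com oa pa (Plus (Cell a (Reg 5)) (Const 2)))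
       (Seq (push_com ob pb (Plus (Cell a (Reg 5)) (Const 2)))
       (Seq (push_com ob pb (Const (1 - z)))
       (Seq (SetReg 15 (Plus (Reg 15) (Const 1)))
         (Cond (Equal (Cell h (Plus (Reg 5) (Const 1))) (Const 0))
           (push_com oa pa (Const z))
           Skip)))))
       Skip)"

lemma w_build_com [simp]:
  "wregs (build_com a h z oa pa ob pb) = {5, 15, pa, pb}"
  "warrs (build_com a h z oa pa ob pb) = {oa, ob}"
  by (auto simp: build_com_def)

lemma run_build_com:
  assumes n: "reg s 0 = length A" and st: "stores s a A" and G: "support s h = G"
    and X: "contents s oa pa X" and Y: "contents s ob pb Y" and w: "reg s 15 = w"
    and distinct: "oa \<noteq> ob" "a \<notin> {oa, ob}" "h \<notin> {oa, ob}" "pa \<noteq> pb"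
      "pa \<notin> {0, 5, 15}" "pb \<notin> {0, 5, 15}"
    and T: "length A * 13 + 2 \<le> T"
  shows "run (build_com a h z oa pa ob pb) s T (\<lambda>s'.
    contents s' oa pa (X @ segments A G z (length A)) \<and>
    contents s' ob pb (Y @ spread A G (1 - z) (length A)) \<and>
    reg s' 15 = w + kept G (length A))"
proof -
  let ?I = "\<lambda>i s'. contents s' oa pa (X @ segments A G z i) \<and>
    contents s' ob pb (Y @ spread A G (1 - z) i) \<and> reg s' 15 = w + kept G i"
  let ?sep = "Cond (Equal (Cell h (Plus (Reg 5) (Const 1))) (Const 0)) (push_com oa pa (Const z)) Skip"
  let ?c4 = "Seq (SetReg 15 (Plus (Reg 15) (Const 1))) ?sep"
  let ?c3 = "Seq (push_com ob pb (Const (1 - z))) ?c4"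
  let ?c2 = "Seq (push_com ob pb (Plus (Cell a (Reg 5)) (Const 2))) ?c3"
  let ?c1 = "Seq (push_com oa pa (Plus (Cell a (Reg 5)) (Const 2))) ?c2"
  let ?body = "Cond (Neg (Conj (Equal (Cell h (Reg 5)) (Const 0))
         (Equal (Cell h (Plus (Reg 5) (Const 1))) (Const 0)))) ?c1 Skip"
  have "run (build_com a h z oa pa ob pb) s T (?I (reg s 0))"
    unfolding build_com_def
  proof (rule run_For[where T = 11])
    fix i s0
    assume i: "i < reg s 0" and ag: "agree (insert 5 (wregs ?body)) (warrs ?body) s s0"
      and i0: "reg s0 5 = i" and I: "?I i s0"
    have G0: "arr s0 h q = 0 \<longleftrightarrow> q \<notin> G" for q
      using ag distinct G by (auto simp: agree_def support_def)
    have A0: "stores s0 a A" using st ag by (rule stores_agree) (use distinct in auto)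
    have body: "run ?c1 s0 10 (?I (Suc i))" if k: "i \<in> G \<or> Suc i \<in> G"
    proof (rule run_Seq)
      show "run (push_com oa pa (Plus (Cell a (Reg 5)) (Const 2))) s0 2
          (\<lambda>s'. contents s' oa pa ((X @ segments A G z i) @ [A ! i + 2]))"
        by (rule run_push_com) (use I A0 i i0 n in \<open>auto simp: stores_def\<close>)
      fix s1 assume ag1: "agree (wregs (push_com oa pa (Plus (Cell a (Reg 5)) (Const 2))))
          (warrs (push_com oa pa (Plus (Cell a (Reg 5)) (Const 2)))) s0 s1"
        and s1: "contents s1 oa pa ((X @ segments A G z i) @ [A ! i + 2])"
      have Y1: "contents s1 ob pb (Y @ spread A G (1 - z) i)"
        by (rule contents_agree[OF _ ag1]) (use I distinct in auto)
      have r1: "arr s1 a = arr s0 a" "arr s1 h = arr s0 h" "reg s1 5 = i" "reg s1 15 = w + kept G i"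
        using ag1 distinct I i0 by (auto simp: agree_def)
      show "run ?c2 s1 8 (?I (Suc i))"
      proof (rule run_Seq)
        show "run (push_com ob pb (Plus (Cell a (Reg 5)) (Const 2))) s1 2
            (\<lambda>s'. contents s' ob pb ((Y @ spread A G (1 - z) i) @ [A ! i + 2]))"
          by (rule run_push_com) (use Y1 A0 i r1 n in \<open>auto simp: stores_def\<close>)
        fix s2 assume ag2: "agree (wregs (push_com ob pb (Plus (Cell a (Reg 5)) (Const 2))))
            (warrs (push_com ob pb (Plus (Cell a (Reg 5)) (Const 2)))) s1 s2"
          and s2: "contents s2 ob pb ((Y @ spread A G (1 - z) i) @ [A ! i + 2])"
        have X2: "contents s2 oa pa ((X @ segments A G z i) @ [A ! i + 2])"
          by (rule contents_agree[OF s1 ag2]) (use distinct in auto)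
        have r2: "arr s2 h = arr s0 h" "reg s2 5 = i" "reg s2 15 = w + kept G i"
          using ag2 distinct r1 by (auto simp: agree_def)
        show "run ?c3 s2 6 (?I (Suc i))"
        proof (rule run_Seq)
          show "run (push_com ob pb (Const (1 - z))) s2 2
              (\<lambda>s'. contents s' ob pb (((Y @ spread A G (1 - z) i) @ [A ! i + 2]) @ [1 - z]))"
            by (rule run_push_com[OF s2]) auto
          fix s3 assume ag3: "agree (wregs (push_com ob pb (Const (1 - z))))
              (warrs (push_com ob pb (Const (1 - z)))) s2 s3"
            and s3: "contents s3 ob pb (((Y @ spread A G (1 - z) i) @ [A ! i + 2]) @ [1 - z])"
          have X3: "contents s3 oa pa ((X @ segments A G z i) @ [A ! i + 2])"
            by (rule contents_agree[OF X2 ag3]) (use distinct in auto)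
          have Y3: "contents s3 ob pb (Y @ spread A G (1 - z) (Suc i))" using s3 k by simp
          have r3: "arr s3 h = arr s0 h" "reg s3 5 = i" "reg s3 15 = w + kept G i"
            using ag3 distinct r2 by (auto simp: agree_def)
          define s4 where "s4 = s3\<lparr>reg := (reg s3)(15 := aval (Plus (Reg 15) (Const 1)) s3)\<rparr>"
          have r4: "arr s4 h = arr s0 h" "reg s4 5 = i" "reg s4 15 = w + kept G (Suc i)"
            using r3 k by (auto simp: s4_def kept_Suc)
          have X4: "contents s4 oa pa ((X @ segments A G z i) @ [A ! i + 2])"
            and Y4: "contents s4 ob pb (Y @ spread A G (1 - z) (Suc i))"
            using X3 Y3 distinct by (auto simp: s4_def contents_def stores_def)
          have "run ?sep s4 3 (?I (Suc i))"
          proof (rule run_Cond)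
            assume "bval (Equal (Cell h (Plus (Reg 5) (Const 1))) (Const 0)) s4"
            then have "Suc i \<notin> G" using r4 G0 by simp
            then have seg: "X @ segments A G z (Suc i) = ((X @ segments A G z i) @ [A ! i + 2]) @ [z]"
              using k by simp
            show "run (push_com oa pa (Const z)) s4 2 (?I (Suc i))"
            proof (rule run_conseq[OF run_push_com[OF X4]])
              fix s5 assume s5: "agree (wregs (push_com oa pa (Const z)))
                  (warrs (push_com oa pa (Const z))) s4 s5"
                "contents s5 oa pa (((X @ segments A G z i) @ [A ! i + 2]) @ [aval (Const z) s4])"
              have "contents s5 ob pb (Y @ spread A G (1 - z) (Suc i))"
                by (rule contents_agree[OF Y4 s5(1)]) (use distinct in auto)
              moreover have "reg s5 15 = w + kept G (Suc i)"
                using s5(1) r4 distinct by (auto simp: agree_def)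
              ultimately show "?I (Suc i) s5" using s5(2) unfolding seg by simp
            qed auto
          next
            assume "\<not> bval (Equal (Cell h (Plus (Reg 5) (Const 1))) (Const 0)) s4"
            then have "Suc i \<in> G" using r4 G0 by simp
            then show "run Skip s4 2 (?I (Suc i))" using X4 Y4 r4 by (intro run_Skip) auto
          qed simp
          then show "run ?c4 s3 4 (?I (Suc i))"
            by (intro run_SetReg_Seq[where T = 3]) (simp_all only: s4_def)
        qed simp
      qed simp
    qed simp
    show "run ?body s0 11 (?I (Suc i))"
    proof (rule run_Cond)
      assume "bval (Neg (Conj (Equal (Cell h (Reg 5)) (Const 0))
         (Equal (Cell h (Plus (Reg 5) (Const 1))) (Const 0)))) s0"
      then show "run ?c1 s0 10 (?I (Suc i))" using i0 G0 by (intro body) simp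
    next
      assume "\<not> bval (Neg (Conj (Equal (Cell h (Reg 5)) (Const 0))
         (Equal (Cell h (Plus (Reg 5) (Const 1))) (Const 0)))) s0"
      then show "run Skip s0 10 (?I (Suc i))"
        using i0 G0 I by (intro run_Skip) (simp_all add: kept_Suc)
    qed simp
  qed (use distinct X Y w T n in \<open>auto simp: contents_def stores_def\<close>)
  then show ?thesis using n by simp
qed

lemma run_fill:
  assumes "contents s a p xs" "reg s r = m" "p \<notin> {5, r}" "r \<noteq> 5" "m * 4 + 2 \<le> T"
  shows "run (For 5 r (push_com a p (Const v))) s T (\<lambda>s'. contents s' a p (xs @ replicate m v))"
proof -
  let ?I = "\<lambda>i s'. contents s' a p (xs @ replicate i v)"
  have "run (For 5 r (push_com a p (Const v))) s T (?I (reg s r))"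
  proof (rule run_For[where T = 2])
    fix i s' assume "?I i s'"
    then have "run (push_com a p (Const v)) s' 2 (\<lambda>s'. contents s' a p ((xs @ replicate i v) @ [v]))"
      by (rule run_push_com) auto
    then show "run (push_com a p (Const v)) s' 2 (?I (Suc i))"
      by (simp add: replicate_append_same)
  qed (use assms in \<open>auto simp: contents_def stores_def\<close>)
  then show ?thesis using assms(2) by simp
qed

text \<open>Both amounts are computed in advance, because the first filling loop changes register
  13, from which the second amount is obtained.\<close>

definition pad_com :: com where
  "pad_com = Seq (SetReg 16 (Minus (Reg 14) (Reg 15))) (Seq (SetReg 17 (Minus (Reg 13) (Reg 15)))
     (Seq (For 5 16 (push_com 4 13 (Const 1))) (For 5 17 (push_com 5 14 (Const 0)))))"

lemma w_pad_com [simp]: "wregs pad_com = {5, 13, 14, 16, 17}" "warrs pad_com = {4, 5}"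
  by (auto simp: pad_com_def)

lemma run_pad_com:
  assumes X: "contents s 4 13 X" and Y: "contents s 5 14 Y" and w: "reg s 15 = w"
    and T: "4 * (length X + length Y) + 6 \<le> T"
  shows "run pad_com s T (\<lambda>s'. contents s' 4 13 (X @ replicate (length Y - w) 1) \<and>
    contents s' 5 14 (Y @ replicate (length X - w) 0))"
    (is "run _ _ _ ?Q")
proof -
  define s1 where "s1 = s\<lparr>reg := (reg s)(16 := length Y - w, 17 := length X - w)\<rparr>"
  have X1: "contents s1 4 13 X" and Y1: "contents s1 5 14 Y"
    using X Y by (auto simp: s1_def contents_def stores_def)
  have pads: "run (Seq (For 5 16 (push_com 4 13 (Const 1))) (For 5 17 (push_com 5 14 (Const 0)))) s1
      (4 * (length X + length Y) + 4) ?Q"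
  proof (rule run_Seq)
    show "run (For 5 16 (push_com 4 13 (Const 1))) s1 (length Y * 4 + 2)
        (\<lambda>s'. contents s' 4 13 (X @ replicate (length Y - w) 1))"
      by (rule run_fill[OF X1]) (auto simp: s1_def)
    fix s2 assume ag: "agree (wregs (For 5 16 (push_com 4 13 (Const 1))))
        (warrs (For 5 16 (push_com 4 13 (Const 1)))) s1 s2"
      and X2: "contents s2 4 13 (X @ replicate (length Y - w) 1)"
    have Y2: "contents s2 5 14 Y" by (rule contents_agree[OF Y1 ag]) auto
    have fill: "run (For 5 17 (push_com 5 14 (Const 0))) s2 (length X * 4 + 2)
        (\<lambda>s'. contents s' 5 14 (Y @ replicate (length X - w) 0))"
      by (rule run_fill[OF Y2]) (use ag in \<open>auto simp: s1_def agree_def\<close>)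
    show "run (For 5 17 (push_com 5 14 (Const 0))) s2 (length X * 4 + 2) ?Q"
    proof (rule run_conseq[OF fill])
      fix s3 assume ag3: "agree (wregs (For 5 17 (push_com 5 14 (Const 0))))
          (warrs (For 5 17 (push_com 5 14 (Const 0)))) s2 s3"
        and Y3: "contents s3 5 14 (Y @ replicate (length X - w) 0)"
      have "contents s3 4 13 (X @ replicate (length Y - w) 1)"
        by (rule contents_agree[OF X2 ag3]) auto
      then show "?Q s3" using Y3 by simp
    qed simp
  qed simp
  have "reg s 13 = length X" "reg s 14 = length Y" using X Y by (auto simp: contents_def)
  then have s1': "s1 = s\<lparr>reg := (reg s)(16 := reg s 14 - reg s 15, 17 := reg s 13 - reg s 15)\<rparr>"
    using w by (simp add: s1_def)
  show ?thesis
    unfolding pad_com_def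
    by (intro run_SetReg_Seq[where T = "4 * (length X + length Y) + 5"]
        run_SetReg_Seq[where T = "4 * (length X + length Y) + 4"])
      (use pads T in \<open>simp_all add: s1'\<close>)
qed

definition copy_com :: com where
  "copy_com = Seq (For 5 13 (Seq (SetCell 0 (Reg 5) (Cell 4 (Reg 5))) (SetCell 1 (Reg 5) (Cell 5 (Reg 5)))))
     (Seq (SetReg 0 (Reg 13)) (SetReg 1 (Reg 13)))"

lemma run_copy_com:
  assumes X: "contents s 4 13 X" and Y: "stores s 5 Y" "length Y = length X" and k: "reg s 2 = k"
    and T: "4 * length X + 4 \<le> T"
  shows "run copy_com s T (\<lambda>s'. represents s' X Y k)"
proof -
  let ?body = "Seq (SetCell 0 (Reg 5) (Cell 4 (Reg 5))) (SetCell 1 (Reg 5) (Cell 5 (Reg 5)))"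
  let ?I = "\<lambda>i s'. \<forall>x<i. arr s' 0 x = X ! x \<and> arr s' 1 x = Y ! x"
  have len: "reg s 13 = length X" using X by (simp add: contents_def)
  have "run (For 5 13 ?body) s (length X * 4 + 2) (?I (reg s 13))"
  proof (rule run_For[where T = 2])
    fix i s0 assume s0: "i < reg s 13" "agree (insert 5 (wregs ?body)) (warrs ?body) s s0"
      "reg s0 5 = i" "?I i s0"
    have cells: "arr s0 4 i = X ! i" "arr s0 5 i = Y ! i"
      using X Y s0(1,2) len by (auto simp: agree_def contents_def stores_def)
    show "run ?body s0 2 (?I (Suc i))"
    proof (rule run_Seq[where ?T1.0 = 1 and ?T2.0 = 1
        and P = "\<lambda>s'. s' = s0\<lparr>arr := (arr s0)(0 := (arr s0 0)(i := X ! i))\<rparr>"])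
      show "run (SetCell 0 (Reg 5) (Cell 4 (Reg 5))) s0 1
          (\<lambda>s'. s' = s0\<lparr>arr := (arr s0)(0 := (arr s0 0)(i := X ! i))\<rparr>)"
        by (rule run_SetCell) (simp_all add: cells s0(3))
      fix s1 assume "s1 = s0\<lparr>arr := (arr s0)(0 := (arr s0 0)(i := X ! i))\<rparr>"
      then show "run (SetCell 1 (Reg 5) (Cell 5 (Reg 5))) s1 1 (?I (Suc i))"
        using s0(3,4) cells by (intro run_SetCell) (auto simp: less_Suc_eq)
    qed simp
  qed (use len in auto)
  then show ?thesis
    unfolding copy_com_def
  proof (rule run_Seq)
    fix s1 assume s1: "agree (wregs (For 5 13 ?body)) (warrs (For 5 13 ?body)) s s1" "?I (reg s 13) s1"
    have "reg s1 13 = length X" "reg s1 2 = k" using s1(1) len k by (auto simp: agree_def)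
    then show "run (Seq (SetReg 0 (Reg 13)) (SetReg 1 (Reg 13))) s1 2 (\<lambda>s'. represents s' X Y k)"
      using s1(2) len Y(2)
      by (intro run_SetReg_Seq[where T = 1] run_SetReg) (auto simp: represents_def)
  qed (use T in simp)
qed

text \<open>Any string of \<open>k + 1\<close> symbols, paired with itself, would do: the identity
  preserves all its \<open>k\<close> duos.\<close>

definition yes_com :: com where
  "yes_com = Seq (SetReg 16 (Plus (Reg 2) (Const 1)))
     (Seq (For 5 16 (Seq (SetCell 0 (Reg 5) (Const 0)) (SetCell 1 (Reg 5) (Const 0))))
     (Seq (SetReg 0 (Reg 16)) (SetReg 1 (Reg 16))))"

lemma run_yes_com:
  assumes k: "reg s 2 = k" and T: "4 * k + 9 \<le> T"
  shows "run yes_com s T (\<lambda>s'. represents s' (replicate (k + 1) 0) (replicate (k + 1) 0) k)"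
proof -
  let ?body = "Seq (SetCell 0 (Reg 5) (Const 0)) (SetCell 1 (Reg 5) (Const 0))"
  let ?I = "\<lambda>i s'. \<forall>x<i. arr s' 0 x = 0 \<and> arr s' 1 x = 0"
  define s1 where "s1 = s\<lparr>reg := (reg s)(16 := Suc k)\<rparr>"
  have len: "reg s1 16 = Suc k" "reg s1 2 = k" using k by (simp_all add: s1_def)
  have "run (For 5 16 ?body) s1 (Suc k * 4 + 2) (?I (reg s1 16))"
  proof (rule run_For[where T = 2])
    fix i and s0 :: store assume s0: "reg s0 5 = i" "?I i s0"
    show "run ?body s0 2 (?I (Suc i))"
    proof (rule run_Seq[where ?T1.0 = 1 and ?T2.0 = 1
        and P = "\<lambda>s'. s' = s0\<lparr>arr := (arr s0)(0 := (arr s0 0)(i := 0))\<rparr>"])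
      show "run (SetCell 0 (Reg 5) (Const 0)) s0 1
          (\<lambda>s'. s' = s0\<lparr>arr := (arr s0)(0 := (arr s0 0)(i := 0))\<rparr>)"
        by (rule run_SetCell) (simp_all add: s0(1))
      fix s2 assume "s2 = s0\<lparr>arr := (arr s0)(0 := (arr s0 0)(i := 0))\<rparr>"
      then show "run (SetCell 1 (Reg 5) (Const 0)) s2 1 (?I (Suc i))"
        using s0 by (intro run_SetCell) (auto simp: less_Suc_eq)
    qed simp
  qed (use len in auto)
  then have "run (Seq (For 5 16 ?body) (Seq (SetReg 0 (Reg 16)) (SetReg 1 (Reg 16)))) s1 (4 * k + 8)
      (\<lambda>s'. represents s' (replicate (k + 1) 0) (replicate (k + 1) 0) k)"
  proof (rule run_Seq)
    fix s2 assume s2: "agree (wregs (For 5 16 ?body)) (warrs (For 5 16 ?body)) s1 s2" "?I (reg s1 16) s2"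
    have "reg s2 16 = Suc k" "reg s2 2 = k" using s2(1) len by (auto simp: agree_def)
    then show "run (Seq (SetReg 0 (Reg 16)) (SetReg 1 (Reg 16))) s2 2
        (\<lambda>s'. represents s' (replicate (k + 1) 0) (replicate (k + 1) 0) k)"
      using s2(2) len
      by (intro run_SetReg_Seq[where T = 1] run_SetReg) (auto simp: represents_def nth_Cons split: nat.split)
  qed simp
  then show ?thesis
    unfolding yes_com_def using T k
    by (intro run_SetReg_Seq[where T = "4 * k + 8"]) (simp_all add: s1_def)
qed

section \<open>Computing the numbers \<open>5 * k ^ 2\<close> and \<open>312 * k ^ 6\<close>\<close>

definition times_com :: "nat \<Rightarrow> com" where
  "times_com x = Seq (SetReg 16 (Const 0)) (Seq (For 5 2 (SetReg 16 (Plus (Reg 16) (Reg x))))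
     (SetReg x (Reg 16)))"

lemma w_times_com [simp]: "wregs (times_com x) = {5, 16, x}" "warrs (times_com x) = {}"
  by (auto simp: times_com_def)

lemma run_times_com:
  assumes "reg s 2 = k" "reg s x = m" "x \<notin> {2, 5, 16}" "3 * k + 4 \<le> T"
  shows "run (times_com x) s T (\<lambda>s'. reg s' x = m * k)"
proof -
  define s1 where "s1 = s\<lparr>reg := (reg s)(16 := 0)\<rparr>"
  have s1: "reg s1 2 = k" "reg s1 x = m" using assms by (auto simp: s1_def)
  let ?body = "SetReg 16 (Plus (Reg 16) (Reg x))"
  have "run (For 5 2 ?body) s1 (k * 3 + 2) (\<lambda>s'. reg s' 16 = m * reg s1 2)"
  proof (rule run_For[where T = 1])
    fix i s2 assume s2: "agree (insert 5 (wregs ?body)) (warrs ?body) s1 s2" "reg s2 16 = m * i"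
    then have "reg s2 x = m" using s1 assms(3) by (auto simp: agree_def)
    then show "run ?body s2 1 (\<lambda>s'. reg s' 16 = m * Suc i)"
      using s2 by (intro run_SetReg) simp_all
  qed (use s1 in \<open>auto simp: s1_def\<close>)
  then have "run (Seq (For 5 2 ?body) (SetReg x (Reg 16))) s1 (3 * k + 3) (\<lambda>s'. reg s' x = m * k)"
    by (rule run_Seq[where ?T2.0 = 1]) (auto intro!: run_SetReg simp: s1)
  then show ?thesis
    unfolding times_com_def using assms(4)
    by (intro run_SetReg_Seq[where T = "3 * k + 3"]) (simp_all add: s1_def)
qed

text \<open>Multiplication by \<open>k\<close> is a \<open>k\<close>-fold addition, as the machine
  offers no multiplication. For a fixed exponent the time is linear in \<open>k\<close>, although
  the value is a higher power of \<open>k\<close>.\<close>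

primrec power_com :: "nat \<Rightarrow> nat \<Rightarrow> com" where
  "power_com 0 x = Skip"
| "power_com (Suc i) x = Seq (power_com i x) (times_com x)"

lemma w_power_com: "wregs (power_com i x) \<subseteq> {5, 16, x}" "warrs (power_com i x) = {}"
  by (induction i) auto

lemma run_power_com:
  assumes "reg s 2 = k" "reg s x = m" "x \<notin> {2, 5, 16}"
  shows "run (power_com i x) s (i * (3 * k + 4) + 1) (\<lambda>s'. reg s' x = m * k ^ i)"
proof (induction i)
  case 0
  then show ?case using assms by (auto intro!: run_Skip)
next
  case (Suc i)
  show ?case
    unfolding power_com.simps
  proof (rule run_Seq[OF Suc])
    fix s' assume s': "agree (wregs (power_com i x)) (warrs (power_com i x)) s s'"
      "reg s' x = m * k ^ i"
    have "reg s' 2 = k" using s'(1) w_power_com(1)[of i x] assms by (auto simp: agree_def)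
    then show "run (times_com x) s' (3 * k + 4) (\<lambda>s'. reg s' x = m * k ^ Suc i)"
      by (rule run_conseq[OF run_times_com[OF _ s'(2) assms(3) order_refl]]) (simp_all add: ac_simps)
  qed simp
qed

definition bounds_com :: com where
  "bounds_com = Seq (SetReg 3 (Const 5)) (Seq (power_com 2 3)
     (Seq (SetReg 4 (Const 312)) (power_com 6 4)))"

lemma w_bounds_com: "wregs bounds_com \<subseteq> {3, 4, 5, 16}" "warrs bounds_com = {}"
  using w_power_com(1)[of 2 3] w_power_com(1)[of 6 4] by (auto simp: bounds_com_def w_power_com(2))

lemma run_bounds_com:
  assumes k: "reg s 2 = k"
  shows "run bounds_com s (24 * k + 36) (\<lambda>s'. reg s' 3 = 5 * k ^ 2 \<and> reg s' 4 = 312 * k ^ 6)"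
    (is "run _ _ _ ?Q")
proof -
  define s1 where "s1 = s\<lparr>reg := (reg s)(3 := 5)\<rparr>"
  have "run (Seq (power_com 2 3) (Seq (SetReg 4 (Const 312)) (power_com 6 4))) s1 (24 * k + 35) ?Q"
  proof (rule run_Seq[OF run_power_com])
    fix s2 assume s2: "agree (wregs (power_com 2 3)) (warrs (power_com 2 3)) s1 s2"
      "reg s2 3 = 5 * k ^ 2"
    define s3 where "s3 = s2\<lparr>reg := (reg s2)(4 := 312)\<rparr>"
    have "agree {5, 16, 3} {} s1 s2"
      using agree_mono[OF s2(1) w_power_com(1)] w_power_com(2) by simp
    then have s3: "reg s3 2 = k" "reg s3 4 = 312" "reg s3 3 = 5 * k ^ 2"
      using k s2(2) by (simp_all add: s3_def s1_def agree_def)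
    have "run (power_com 6 4) s3 (6 * (3 * k + 4) + 1) ?Q"
    proof (rule run_conseq[OF run_power_com[OF s3(1,2)]])
      fix s4 assume s4: "agree (wregs (power_com 6 4)) (warrs (power_com 6 4)) s3 s4"
        "reg s4 4 = 312 * k ^ 6"
      have "agree {5, 16, 4} {} s3 s4"
        using agree_mono[OF s4(1) w_power_com(1)] w_power_com(2) by simp
      then show "?Q s4" using s3(3) s4(2) by (simp add: agree_def)
    qed simp_all
    then show "run (Seq (SetReg 4 (Const 312)) (power_com 6 4)) s2 (18 * k + 26) ?Q"
      by (intro run_SetReg_Seq[where T = "6 * (3 * k + 4) + 1"]) (simp_all add: s3_def)
  qed (use k in \<open>auto simp: s1_def\<close>)
  then show ?thesis
    unfolding bounds_com_def by (intro run_SetReg_Seq[where T = "24 * k + 35"]) (simp_all add: s1_def)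
qed

section \<open>The complete kernelization\<close>

definition output_com :: com where
  "output_com = Seq pad_com (Cond (Less (Reg 4) (Reg 13)) yes_com copy_com)"

definition kernel_com :: com where
  "kernel_com = Seq bounds_com (Seq (marks_com 0 1 2) (Seq (marks_com 1 0 3)
     (Seq (build_com 0 2 0 4 13 5 14) (Seq (build_com 1 3 1 5 14 4 13) output_com))))"

definition reduced_to :: "nat list \<Rightarrow> nat list \<Rightarrow> nat \<Rightarrow> store \<Rightarrow> bool" where
  "reduced_to A B k s' \<longleftrightarrow> (\<exists>A' B'. represents s' A' B' k \<and> related A' B' \<and>
     length A' \<le> 312 * k ^ 6 \<and> (max_duo_psm A B k \<longleftrightarrow> max_duo_psm A' B' k))"

lemma max_duo_psm_replicate: "max_duo_psm (replicate (k + 1) x) (replicate (k + 1) x) k"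
proof -
  have "is_mapping id (replicate (k + 1) x) (replicate (k + 1) x)"
    by (simp add: is_mapping_def)
  moreover have "preserved_duos id (replicate (k + 1) x) = {..<k}"
    by (auto simp: preserved_duos_def)
  ultimately show ?thesis by (auto simp: max_duo_psm_def)
qed

lemma represents_agree:
  "represents s A B k \<Longrightarrow> agree W V s s' \<Longrightarrow> 0 \<notin> W \<Longrightarrow> 1 \<notin> W \<Longrightarrow> 2 \<notin> W \<Longrightarrow> 0 \<notin> V \<Longrightarrow> 1 \<notin> V \<Longrightarrow>
     represents s' A B k"
  by (simp add: represents_def agree_def)

lemma represents_stores: "represents s A B k \<Longrightarrow> stores s 0 A" "represents s A B k \<Longrightarrow> stores s 1 B"
  by (simp_all add: represents_def stores_def)

lemma kept_le_length: "kept G n \<le> n"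
  by (induction n) (auto simp: kept_Suc)

text \<open>If the size test fails, the contrapositive of \<open>length_kernel_bound\<close> shows
  that the given instance is a yes-instance, and the trivial one replaces it. Otherwise the kernel
  is small and equivalent to the given instance.\<close>

lemma run_output_com:
  assumes rel: "related A B" and k: "reg s 2 = k" "0 < k" and M: "reg s 4 = 312 * k ^ 6"
    and G: "G = marks (5 * k * k) k A B" and H: "H = marks (5 * k * k) k B A"
    and X: "contents s 4 13 (segments A G 0 (length A) @ spread B H 0 (length B))"
    and Y: "contents s 5 14 (spread A G 1 (length A) @ segments B H 1 (length B))"
    and w: "reg s 15 = kept G (length A) + kept H (length B)"
  shows "run output_com s (64 * length A + 4 * k + 16) (reduced_to A B k)"
proof -
  let ?X = "segments A G 0 (length A) @ spread B H 0 (length B)"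
  let ?Y = "spread A G 1 (length A) @ segments B H 1 (length B)"
  have len: "length B = length A" using rel mset_eq_length unfolding related_def by metis
  have "length ?X + length ?Y \<le> 4 * (kept G (length A) + kept H (length B))"
    using length_segments_bounds(2)[of A G 0 "length A"] length_segments_bounds(2)[of B H 1 "length B"]
    by (simp add: length_spread)
  also have "\<dots> \<le> 8 * length A"
    using kept_le_length[of G "length A"] kept_le_length[of H "length B"] len by simp
  finally have XY: "length ?X + length ?Y \<le> 8 * length A" .
  let ?A = "kernel_left A B G H" and ?B = "kernel_right A B G H"
  have kernel: "?A = ?X @ replicate (length ?Y - (kept G (length A) + kept H (length B))) 1"
    "?B = ?Y @ replicate (length ?X - (kept G (length A) + kept H (length B))) 0"
    by (simp_all add: kernel_left_def kernel_right_def length_spread)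
  have lenA: "length ?A \<le> 8 * length A" using XY unfolding kernel(1) by simp
  have lenB: "length ?B = length ?A"
    using related_kernel mset_eq_length unfolding related_def by metis
  \<comment> \<open>Ensures that the trivial instance, of length \<open>k + 1\<close>, also obeys
    the size bound.\<close>
  have k6: "1 \<le> k ^ 6" "k \<le> k ^ 6" using k(2) self_le_power[of k 6] by simp_all
  show ?thesis
    unfolding output_com_def
  proof (rule run_Seq[OF run_pad_com[OF X Y w order_refl]])
    fix s1 assume ag: "agree (wregs pad_com) (warrs pad_com) s s1"
      and "contents s1 4 13 (?X @ replicate (length ?Y - (kept G (length A) + kept H (length B))) 1) \<and>
        contents s1 5 14 (?Y @ replicate (length ?X - (kept G (length A) + kept H (length B))) 0)"
    then have s1: "contents s1 4 13 ?A" "contents s1 5 14 ?B" unfolding kernel by blast+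
    have regs: "reg s1 2 = k" "reg s1 4 = 312 * k ^ 6" "reg s1 13 = length ?A"
      using ag k M s1(1) by (auto simp: agree_def contents_def)
    show "run (Cond (Less (Reg 4) (Reg 13)) yes_com copy_com) s1 (32 * length A + 4 * k + 10)
        (reduced_to A B k)"
    proof (rule run_Cond)
      assume "bval (Less (Reg 4) (Reg 13)) s1"
      then have "max_duo_psm A B k"
        using length_kernel_bound[OF rel, of k] regs G H by fastforce
      then have "reduced_to A B k s'"
        if "represents s' (replicate (k + 1) 0) (replicate (k + 1) 0) k" for s'
        using that max_duo_psm_replicate[of k 0] k6 unfolding reduced_to_def
        by (intro exI[of _ "replicate (k + 1) 0"]) (auto simp: related_def)
      then show "run yes_com s1 (32 * length A + 4 * k + 9) (reduced_to A B k)"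
        by (intro run_conseq[OF run_yes_com[OF regs(1) order_refl]]) simp_all
    next
      assume "\<not> bval (Less (Reg 4) (Reg 13)) s1"
      then have small: "length ?A \<le> 312 * k ^ 6" using regs by simp
      have "5 * k * k > 2 * k * (k + 1)" using k(2) by (simp add: algebra_simps)
      then have "max_duo_psm ?A ?B k \<longleftrightarrow> max_duo_psm A B k"
        unfolding G H by (rule max_duo_psm_kernel[OF rel])
      then have "reduced_to A B k s'" if "represents s' ?A ?B k" for s'
        using that small related_kernel unfolding reduced_to_def by blast
      then show "run copy_com s1 (32 * length A + 4 * k + 9) (reduced_to A B k)"
        using lenA s1(2)
        by (intro run_conseq[OF run_copy_com[OF s1(1) _ lenB regs(1) order_refl]])
          (simp_all add: contents_def)
    qed simp
  qed (use XY in simp)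
qed

text \<open>The leading term pays for marking both strings. The rest is linear:
  \<open>90 = 13 + 13 + 64\<close> from building and output, and \<open>28 = 24 + 4\<close> from the
  bounds and the trivial instance.\<close>

lemma run_kernel_com:
  assumes rel: "related A B" and k: "0 < k"
  shows "run kernel_com (input_store A B k)
    (2 * (length A * (k * (length A * (7 * k + 16) + 6) + 4) + 2) + 90 * length A + 28 * k + 56)
    (reduced_to A B k)"
proof -
  let ?s = "input_store A B k" and ?n = "length A" and ?L = "5 * k * k"
  let ?T = "?n * (k * (?n * (7 * k + 16) + 6) + 4) + 2"
  have len: "length B = length A" using rel mset_eq_length unfolding related_def by metis
  define G where "G = marks ?L k A B"
  define H where "H = marks ?L k B A"
  have inp: "reg ?s 13 = 0" "reg ?s 14 = 0" "reg ?s 15 = 0" "support ?s 2 = {}" "support ?s 3 = {}"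
    by (simp_all add: input_store_def support_def)
  show ?thesis
    unfolding kernel_com_def
  proof (rule run_Seq[OF run_bounds_com])
    show "reg ?s 2 = k" by (simp add: input_store_def)
    fix s1 assume "agree (wregs bounds_com) (warrs bounds_com) ?s s1"
      and b: "reg s1 3 = 5 * k ^ 2 \<and> reg s1 4 = 312 * k ^ 6"
    then have ag1: "agree {3, 4, 5, 16} {} ?s s1"
      using agree_mono[OF _ w_bounds_com(1)] w_bounds_com(2) by simp
    have rep1: "represents s1 A B k"
      by (rule represents_agree[OF represents_input_store ag1]) auto
    have s1: "reg s1 0 = ?n" "reg s1 2 = k" "reg s1 3 = ?L" "reg s1 4 = 312 * k ^ 6"
      "reg s1 13 = 0" "reg s1 14 = 0" "reg s1 15 = 0" "support s1 2 = {}" "support s1 3 = {}"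
      using rep1 b ag1 inp by (auto simp: represents_def agree_def support_def power2_eq_square)
    show "run (Seq (marks_com 0 1 2) (Seq (marks_com 1 0 3)
        (Seq (build_com 0 2 0 4 13 5 14) (Seq (build_com 1 3 1 5 14 4 13) output_com)))) s1
        (2 * ?T + 90 * ?n + 4 * k + 20) (reduced_to A B k)"
    proof (rule run_Seq[OF run_marks_com])
      show "length B = ?n" by (rule len)
      show "stores s1 0 A" "stores s1 1 B" using rep1 by (rule represents_stores)+
      fix s2 assume ag2: "agree (wregs (marks_com 0 1 2)) (warrs (marks_com 0 1 2)) s1 s2"
        and G2: "support s2 2 = marks ?L k A B"
      have rep2: "represents s2 A B k" by (rule represents_agree[OF rep1 ag2]) auto
      have s2: "reg s2 0 = ?n" "reg s2 2 = k" "reg s2 3 = ?L" "reg s2 4 = 312 * k ^ 6"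
        "reg s2 13 = 0" "reg s2 14 = 0" "reg s2 15 = 0" "support s2 3 = {}"
        using ag2 s1 by (auto simp: agree_def support_def)
      show "run (Seq (marks_com 1 0 3)
          (Seq (build_com 0 2 0 4 13 5 14) (Seq (build_com 1 3 1 5 14 4 13) output_com))) s2
          (?T + 90 * ?n + 4 * k + 20) (reduced_to A B k)"
      proof (rule run_Seq[OF run_marks_com])
        show "length A = length B" "reg s2 0 = length B" using len s2 by simp_all
        show "stores s2 1 B" "stores s2 0 A" using rep2 by (rule represents_stores)+
        fix s3 assume ag3: "agree (wregs (marks_com 1 0 3)) (warrs (marks_com 1 0 3)) s2 s3"
          and H3: "support s3 3 = marks ?L k B A"
        have rep3: "represents s3 A B k" by (rule represents_agree[OF rep2 ag3]) auto
        have s3: "reg s3 0 = ?n" "reg s3 2 = k" "reg s3 4 = 312 * k ^ 6"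
          "reg s3 13 = 0" "reg s3 14 = 0" "reg s3 15 = 0" "support s3 2 = G" "support s3 3 = H"
          using ag3 s2 G2 H3 by (auto simp: agree_def support_def G_def H_def)
        show "run (Seq (build_com 0 2 0 4 13 5 14) (Seq (build_com 1 3 1 5 14 4 13) output_com)) s3
            (90 * ?n + 4 * k + 20) (reduced_to A B k)"
        proof (rule run_Seq[OF run_build_com])
          show "stores s3 0 A" using rep3 by (rule represents_stores)
          show "contents s3 4 13 []" "contents s3 5 14 []"
            using s3 by (simp_all add: contents_def stores_def)
          fix s4 assume ag4: "agree (wregs (build_com 0 2 0 4 13 5 14))
              (warrs (build_com 0 2 0 4 13 5 14)) s3 s4"
            and b4: "contents s4 4 13 ([] @ segments A G 0 ?n) \<and>
              contents s4 5 14 ([] @ spread A G (1 - 0) ?n) \<and> reg s4 15 = 0 + kept G ?n"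
          have rep4: "represents s4 A B k" by (rule represents_agree[OF rep3 ag4]) auto
          have s4: "reg s4 0 = length B" "reg s4 2 = k" "reg s4 4 = 312 * k ^ 6" "support s4 3 = H"
            using ag4 s3 len by (auto simp: agree_def support_def)
          show "run (Seq (build_com 1 3 1 5 14 4 13) output_com) s4
              (77 * ?n + 4 * k + 18) (reduced_to A B k)"
          proof (rule run_Seq[OF run_build_com])
            show "stores s4 1 B" using rep4 by (rule represents_stores)
            show "contents s4 4 13 (segments A G 0 ?n)" "contents s4 5 14 (spread A G 1 ?n)"
              "reg s4 15 = kept G ?n"
              using b4 by simp_all
            fix s5 assume ag5: "agree (wregs (build_com 1 3 1 5 14 4 13))
                (warrs (build_com 1 3 1 5 14 4 13)) s4 s5"
              and b5: "contents s5 5 14 (spread A G 1 ?n @ segments B H 1 (length B)) \<and>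
                contents s5 4 13 (segments A G 0 ?n @ spread B H (1 - 1) (length B)) \<and>
                reg s5 15 = kept G ?n + kept H (length B)"
            have "reg s5 2 = k" "reg s5 4 = 312 * k ^ 6" using ag5 s4 by (auto simp: agree_def)
            then show "run output_com s5 (64 * ?n + 4 * k + 16) (reduced_to A B k)"
              by (rule run_output_com[OF rel _ k _ G_def H_def]) (use b5 in simp_all)
          qed (use s4 len in auto)
        qed (use s3 in auto)
      qed (use s2 len in auto)
    qed (use s1 in auto)
  qed simp
qed

text \<open>For \<open>k = 0\<close> the size bound forces empty output strings, and
  \<open>5 * k * k\<close> is too small for the relocation argument. For empty input the time bound
  is constant, so not even the work linear in \<open>k\<close> for the constants is affordable; the
  instance stays as it is.\<close>

definition program :: com where
  "program = Cond (Equal (Reg 2) (Const 0)) (Seq (SetReg 0 (Const 0)) (SetReg 1 (Const 0)))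
     (Cond (Equal (Reg 0) (Const 0)) Skip kernel_com)"

text \<open>After expansion every monomial is at most \<open>n ^ 2 * k ^ 2\<close>, as both numbers
  are positive, and the coefficients add up to 244.\<close>

lemma kernel_time_bound:
  fixes n k :: nat
  assumes "0 < n" "0 < k"
  shows "2 * (n * (k * (n * (7 * k + 16) + 6) + 4) + 2) + 90 * n + 28 * k + 56 \<le> 300 * (n ^ 2 * k ^ 2)"
proof -
  have bounds: "1 * k \<le> n ^ 2 * k ^ 2" "n * 1 \<le> n ^ 2 * k ^ 2" "1 * 1 \<le> n ^ 2 * k ^ 2"
    "n * k \<le> n ^ 2 * k ^ 2" "n ^ 2 * k \<le> n ^ 2 * k ^ 2"
    using assms self_le_power[of n 2] self_le_power[of k 2] one_le_power[of n 2] one_le_power[of k 2]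
    by (intro mult_mono; simp)+
  have arith: "a \<le> y \<Longrightarrow> b \<le> y \<Longrightarrow> 1 \<le> y \<Longrightarrow> c \<le> y \<Longrightarrow> d \<le> y \<Longrightarrow>
      14 * y + 32 * d + 12 * c + 98 * b + 28 * a + 60 \<le> 300 * y" for a b c d y :: nat
    by simp
  have "2 * (n * (k * (n * (7 * k + 16) + 6) + 4) + 2) + 90 * n + 28 * k + 56 =
      14 * (n ^ 2 * k ^ 2) + 32 * (n ^ 2 * k) + 12 * (n * k) + 98 * n + 28 * k + 60"
    by (simp add: algebra_simps power2_eq_square)
  also have "\<dots> \<le> 300 * (n ^ 2 * k ^ 2)"
    using bounds by (intro arith) simp_all
  finally show ?thesis .
qed

lemma run_program:
  assumes "related A B"
  shows "run program (input_store A B k) (300 * (length A ^ 2 * k ^ 2) + 3) (reduced_to A B k)"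
  unfolding program_def
proof (rule run_Cond)
  assume "bval (Equal (Reg 2) (Const 0)) (input_store A B k)"
  then have "k = 0" by (simp add: input_store_def)
  moreover have "max_duo_psm C D 0" if "related C D" for C D :: "nat list"
    using is_mapping_exists[OF that] by (auto simp: max_duo_psm_def)
  ultimately have "reduced_to A B k s'" if "represents s' [] [] 0" for s'
    using that assms unfolding reduced_to_def
    by (intro exI[of _ "[]"]) (auto simp: related_def)
  then show "run (Seq (SetReg 0 (Const 0)) (SetReg 1 (Const 0))) (input_store A B k)
      (300 * (length A ^ 2 * k ^ 2) + 2) (reduced_to A B k)"
    using \<open>k = 0\<close> by (intro run_SetReg_Seq[where T = 1] run_SetReg)
      (simp_all add: represents_def input_store_def)
next
  assume "\<not> bval (Equal (Reg 2) (Const 0)) (input_store A B k)"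
  then have k: "0 < k" by (simp add: input_store_def)
  show "run (Cond (Equal (Reg 0) (Const 0)) Skip kernel_com) (input_store A B k)
      (300 * (length A ^ 2 * k ^ 2) + 2) (reduced_to A B k)"
  proof (rule run_Cond)
    assume "bval (Equal (Reg 0) (Const 0)) (input_store A B k)"
    then have "A = []" by (simp add: input_store_def)
    then have "reduced_to A B k (input_store A B k)"
      unfolding reduced_to_def using assms represents_input_store
      by (intro exI[of _ A] exI[of _ B]) auto
    then show "run Skip (input_store A B k) (300 * (length A ^ 2 * k ^ 2) + 1) (reduced_to A B k)"
      by (intro run_Skip) auto
  next
    assume "\<not> bval (Equal (Reg 0) (Const 0)) (input_store A B k)"
    then have "0 < length A" by (simp add: input_store_def)
    then show "run kernel_com (input_store A B k) (300 * (length A ^ 2 * k ^ 2) + 1) (reduced_to A B k)"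
      using kernel_time_bound[OF _ k, of "length A"]
      by (intro run_conseq[OF run_kernel_com[OF assms k]]) simp_all
  qed simp
qed simp

theorem theorem2:
  "\<exists>(P :: com) (c :: real) (d :: real). \<forall>(A :: nat list) (B :: nat list) (k :: nat).
     related A B \<longrightarrow>
     (\<exists>t s' A' B'.
        exec P (input_store A B k) t s' \<and>
        real t \<le> c * (1 + real (length A) powr (5 / 2) * real k ^ 6) \<and>
        represents s' A' B' k \<and>
        related A' B' \<and>
        real (length A') \<le> d * real k ^ 6 \<and>
        real (length B') \<le> d * real k ^ 6 \<and>
        (max_duo_psm A B k \<longleftrightarrow> max_duo_psm A' B' k))"
proof (rule exI[of _ program], rule exI[of _ 300], rule exI[of _ 312], intro allI impI)
  fix A B :: "nat list" and k :: nat
  assume rel: "related A B"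
  obtain t s' where run: "exec program (input_store A B k) t s'"
    "t \<le> 300 * (length A ^ 2 * k ^ 2) + 3" "reduced_to A B k s'"
    using run_program[OF rel, of k] by (auto simp: run_def)
  obtain A' B' where red: "represents s' A' B' k" "related A' B'" "length A' \<le> 312 * k ^ 6"
    "max_duo_psm A B k \<longleftrightarrow> max_duo_psm A' B' k"
    using run(3) by (auto simp: reduced_to_def)
  \<comment> \<open>Length 0 is split off because \<open>powr\<close> grows with the exponent only
    for bases from 1 on.\<close>
  have "real (length A) ^ 2 \<le> real (length A) powr (5 / 2)"
  proof (cases "length A = 0")
    case False
    then have "real (length A) powr 2 \<le> real (length A) powr (5 / 2)"
      by (intro powr_mono) (simp_all add: Suc_le_eq)
    then show ?thesis using False by (simp add: powr_numeral)
  qed simp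
  moreover have "real k ^ 2 \<le> real k ^ 6"
    by (cases "k = 0") (auto intro: power_increasing)
  ultimately have "real (length A) ^ 2 * real k ^ 2 \<le> real (length A) powr (5 / 2) * real k ^ 6"
    by (intro mult_mono) auto
  moreover have "real t \<le> real (300 * (length A ^ 2 * k ^ 2) + 3)"
    using run(2) by (rule of_nat_mono)
  \<comment> \<open>The additive 3 is absorbed by the summand 1 of the bound.\<close>
  ultimately have time: "real t \<le> 300 * (1 + real (length A) powr (5 / 2) * real k ^ 6)"
    by simp
  have "real (length A') \<le> real (312 * k ^ 6)" using red(3) by (rule of_nat_mono)
  then have size: "real (length A') \<le> 312 * real k ^ 6" by simp
  have "length B' = length A'"
    using red(2) mset_eq_length unfolding related_def by metis
  then show "\<exists>t s' A' B'.
        exec program (input_store A B k) t s' \<and>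
        real t \<le> 300 * (1 + real (length A) powr (5 / 2) * real k ^ 6) \<and>
        represents s' A' B' k \<and>
        related A' B' \<and>
        real (length A') \<le> 312 * real k ^ 6 \<and>
        real (length B') \<le> 312 * real k ^ 6 \<and>
        (max_duo_psm A B k \<longleftrightarrow> max_duo_psm A' B' k)"
    using run(1) red time size by (intro exI[of _ t] exI[of _ s'] exI[of _ A'] exI[of _ B']) auto
qed

end
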